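(* Let $n\geq 1$ and let $\alpha,\beta\in\mathbb{Z}_{\geq 0}^n$ be compositions, with key polynomials $\kappa_\alpha(x)$ and $\kappa_\beta(x)$. Then $\mathrm{Newton}(\kappa_\beta)\subseteq\mathrm{Newton}(\kappa_\alpha)$ if and only if $\beta\leq_\kappa\alpha$.
   Context: A composition is a vector $\alpha=(\alpha_1,\ldots,\alpha_n)\in\mathbb{Z}_{\geq 0}^n$. Key polynomials: for $1\le i\le n-1$ and a polynomial $f\in\mathbb{Z}[x_1,\ldots,x_n]$, let $s_if$ be obtained from $f$ by exchanging $x_i$ and $x_{i+1}$, let $\partial_i(f)=\frac{f-s_if}{x_i-x_{i+1}}$, and let $\pi_i(f)=\partial_i(x_if)$. If $\alpha$ is weakly decreasing ($\alpha_1\geq\cdots\geq\alpha_n$), set $\kappa_\alpha(x)=x^\alpha=x_1^{\alpha_1}\cdots x_n^{\alpha_n}$. Otherwise choose $i$ with $\alpha_i<\alpha_{i+1}$, let $\alpha'$ be obtained from $\alpha$ by interchanging $\alpha_i$ and $\alpha_{i+1}$, and set $\kappa_\alpha(x)=\pi_i(\kappa_{\alpha'}(x))$; this is independent of the choice of $i$. For $f=\sum_{\gamma\in\mathbb{Z}_{\geq 0}^n}c_\gamma x^\gamma\in\mathbb{R}[x_1,\ldots,x_n]$, the Newton polytope $\mathrm{Newton}(f)\subseteq\mathbb{R}^n$ is the convex hull of $\{\gamma: c_\gamma\neq 0\}$. For $1\leq i<j\leq n$ and a composition $\gamma$, let $t_{i,j}(\gamma)$ be obtained from $\gamma$ by interchanging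 $\gamma_i$ and $\gamma_j$, and let $m_{i,j}(\gamma)=\gamma+e_i-e_j$, where $e_k$ is the $k$-th standard coordinate vector. Define $\beta\leq_\kappa\alpha$ if $\beta$ can be obtained from $\alpha$ by a finite (possibly empty) sequence of moves, each of which replaces the current composition $\gamma$ either by $t_{i,j}(\gamma)$ for some $i<j$ with $\gamma_i<\gamma_j$, or by $m_{i,j}(\gamma)$ for some $i<j$ with $\gamma_i<\gamma_j-1$. *)

theory Defs
  imports "HOL-Analysis.Analysis" "HOL-Library.Poly_Mapping"
begin

text \<open>
  The index set \<open>{1,\<dots>,n}\<close> is a finite linearly ordered type \<open>'n\<close> with \<open>n = CARD('n) \<ge> 1\<close>;
  up to order isomorphism there is exactly one such type of each positive size.
  A composition in \<open>\<int>\<^sub>\<ge>\<^sub>0\<^sup>n\<close> is an element of \<open>'n \<Rightarrow>\<^sub>0 nat\<close>, which is simultaneously the type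
  of exponent vectors: \<open>('n \<Rightarrow>\<^sub>0 nat) \<Rightarrow>\<^sub>0 'a\<close>, with the convolution product of
  \<^theory>\<open>HOL-Library.Poly_Mapping\<close>, is the polynomial ring in \<open>x\<^sub>1,\<dots>,x\<^sub>n\<close> over \<open>'a\<close>.
\<close>

type_synonym 'n composition = "'n \<Rightarrow>\<^sub>0 nat"
type_synonym ('n, 'a) mpolynomial = "('n \<Rightarrow>\<^sub>0 nat) \<Rightarrow>\<^sub>0 'a"

abbreviation entry :: "'n composition \<Rightarrow> 'n \<Rightarrow> nat" where
  "entry \<equiv> Poly_Mapping.lookup"

abbreviation unit_vec :: "'n \<Rightarrow> 'n composition" where
  "unit_vec k \<equiv> Poly_Mapping.single k 1"

text \<open>\<open>i\<close> and \<open>j\<close> are consecutive indices, that is, \<open>j = i + 1\<close>.\<close>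

definition consecutive :: "'n::linorder \<Rightarrow> 'n \<Rightarrow> bool" where
  "consecutive i j \<longleftrightarrow> i < j \<and> \<not> (\<exists>k. i < k \<and> k < j)"

definition interchange :: "'n \<Rightarrow> 'n \<Rightarrow> 'n composition \<Rightarrow> 'n composition" where
  "interchange i j \<gamma> = Poly_Mapping.map_key (Transposition.transpose i j) \<gamma>"


subsection \<open>Key polynomials\<close>

abbreviation monomial :: "'n composition \<Rightarrow> ('n, 'a::zero_neq_one) mpolynomial" where
  "monomial \<gamma> \<equiv> Poly_Mapping.single \<gamma> 1"

abbreviation var :: "'n \<Rightarrow> ('n, 'a::zero_neq_one) mpolynomial" where
  "var k \<equiv> monomial (unit_vec k)"

text \<open>
  The coefficient of \<open>x\<^sup>\<gamma>\<close> in \<open>exchange_vars i j f\<close> is the coefficient of \<open>x\<^bsup>\<gamma>'\<^esup>\<close> in \<open>f\<close>, where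
  \<open>\<gamma>'\<close> is \<open>\<gamma>\<close> with entries \<open>i\<close> and \<open>j\<close> interchanged; so \<open>exchange_vars i j\<close> with \<open>j = i + 1\<close> is
  the operator \<open>s\<^sub>i\<close>.
\<close>

definition exchange_vars :: "'n \<Rightarrow> 'n \<Rightarrow> ('n, 'a::zero) mpolynomial \<Rightarrow> ('n, 'a) mpolynomial" where
  "exchange_vars i j f = Poly_Mapping.map_key (interchange i j) f"

text \<open>
  The quotient \<open>(f - s\<^sub>i f) / (x\<^sub>i - x\<^sub>j)\<close>; it exists and is unique by
  \<open>divided_difference_mult\<close> and \<open>divided_difference_eqI\<close> below.
\<close>

definition divided_difference ::
    "'n::linorder \<Rightarrow> 'n \<Rightarrow> ('n, int) mpolynomial \<Rightarrow> ('n, int) mpolynomial" where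
  "divided_difference i j f = (THE g. g * (var i - var j) = f - exchange_vars i j f)"

definition demazure ::
    "'n::linorder \<Rightarrow> 'n \<Rightarrow> ('n, int) mpolynomial \<Rightarrow> ('n, int) mpolynomial" where
  "demazure i j f = divided_difference i j (var i * f)"

definition weakly_decreasing :: "'n::linorder composition \<Rightarrow> bool" where
  "weakly_decreasing \<alpha> \<longleftrightarrow> (\<forall>i j. i \<le> j \<longrightarrow> entry \<alpha> j \<le> entry \<alpha> i)"

definition ascent :: "'n::linorder composition \<Rightarrow> 'n \<Rightarrow> 'n \<Rightarrow> bool" where
  "ascent \<alpha> i j \<longleftrightarrow> consecutive i j \<and> entry \<alpha> i < entry \<alpha> j"

lemma inj_transpose [simp]: "inj (Transposition.transpose i j)"
  by (metis injI transpose_involutory)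

lemma lookup_interchange [simp]:
  "entry (interchange i j \<gamma>) k = entry \<gamma> (Transposition.transpose i j k)"
  by (simp add: interchange_def map_key.rep_eq)

lemma ascent_exists:
  fixes \<alpha> :: "'n::{finite,linorder} composition"
  assumes "\<not> weakly_decreasing \<alpha>"
  shows "\<exists>i j. ascent \<alpha> i j"
proof (rule ccontr)
  assume none: "\<nexists>i j. ascent \<alpha> i j"
  have "entry \<alpha> j \<le> entry \<alpha> i" if "i \<le> j" for i j
    using that
  proof (induction "card {i<..j}" arbitrary: i rule: less_induct)
    case less
    show ?case
    proof (cases "i = j")
      case False
      with less.prems have "i < j" by simp
      define k where "k = Min {i<..j}"
      have k: "k \<in> {i<..j}"
        unfolding k_def using \<open>i < j\<close> by (intro Min_in) auto
      have "\<not> (l < k)" if "i < l" for l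
      proof
        assume "l < k"
        with that k have "l \<in> {i<..j}" by auto
        then have "k \<le> l" unfolding k_def by (intro Min_le) auto
        with \<open>l < k\<close> show False by simp
      qed
      with k have "consecutive i k" by (auto simp: consecutive_def)
      with none have "entry \<alpha> k \<le> entry \<alpha> i" by (auto simp: ascent_def not_less)
      moreover have "{k<..j} \<subset> {i<..j}" using k by auto
      then have "card {k<..j} < card {i<..j}" by (intro psubset_card_mono) auto
      with less.hyps k have "entry \<alpha> j \<le> entry \<alpha> k" by auto
      ultimately show ?thesis by simp
    qed simp
  qed
  with assms show False by (auto simp: weakly_decreasing_def)
qed

definition strict_rises :: "'n::linorder composition \<Rightarrow> ('n \<times> 'n) set" where
  "strict_rises \<alpha> = {(i, j). i < j \<and> entry \<alpha> i < entry \<alpha> j}"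

lemma strict_rises_interchange:
  fixes \<alpha> :: "'n::{finite,linorder} composition"
  assumes "ascent \<alpha> i j"
  shows "card (strict_rises (interchange i j \<alpha>)) < card (strict_rises \<alpha>)"
proof -
  let ?t = "Transposition.transpose i j"
  have ij: "i < j" "entry \<alpha> i < entry \<alpha> j" and nb: "\<And>k. \<not> (i < k \<and> k < j)"
    using assms by (auto simp: ascent_def consecutive_def)
  have sub: "map_prod ?t ?t ` strict_rises (interchange i j \<alpha>) \<subseteq> strict_rises \<alpha> - {(i, j)}"
  proof (clarsimp simp: strict_rises_def, intro conjI)
    fix a b
    assume ab: "a < b" "entry \<alpha> (?t a) < entry \<alpha> (?t b)"
    have ne: "\<not> (a = i \<and> b = j)" using ab ij by auto
    then show "?t a < ?t b"
      using ab(1) ij(1) nb[of a] nb[of b] by (auto simp: Transposition.transpose_def not_less)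
    show "?t a = i \<longrightarrow> ?t b \<noteq> j"
      using ab(1) ij(1) by (auto simp: Transposition.transpose_def split: if_splits)
  qed
  have "inj (map_prod ?t ?t)" by (intro prod.inj_map) auto
  then have "card (strict_rises (interchange i j \<alpha>))
      = card (map_prod ?t ?t ` strict_rises (interchange i j \<alpha>))"
    by (metis card_image inj_on_subset subset_UNIV)
  also have "\<dots> \<le> card (strict_rises \<alpha> - {(i, j)})"
    by (intro card_mono sub) auto
  also have "\<dots> < card (strict_rises \<alpha>)"
    using ij by (intro psubset_card_mono) (auto simp: strict_rises_def)
  finally show ?thesis .
qed

text \<open>
  One ascent is chosen at each step; \<open>key_poly_ascent\<close> below shows that the choice is immaterial.
\<close>

definition chosen_ascent :: "'n::{finite,linorder} composition \<Rightarrow> 'n \<times> 'n" where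
  "chosen_ascent \<alpha> = (SOME p. ascent \<alpha> (fst p) (snd p))"

lemma chosen_ascent:
  assumes "\<not> weakly_decreasing \<alpha>"
  shows "ascent \<alpha> (fst (chosen_ascent \<alpha>)) (snd (chosen_ascent \<alpha>))"
  unfolding chosen_ascent_def
  by (rule someI_ex) (use ascent_exists[OF assms] in auto)

function key_poly :: "'n::{finite,linorder} composition \<Rightarrow> ('n, int) mpolynomial" where
  "key_poly \<alpha> =
    (if weakly_decreasing \<alpha> then monomial \<alpha>
     else let (i, j) = chosen_ascent \<alpha> in demazure i j (key_poly (interchange i j \<alpha>)))"
  by pat_completeness auto
termination
proof (relation "Wellfounded.measure (\<lambda>\<alpha>. card (strict_rises \<alpha>))")
  fix \<alpha> :: "'n::{finite,linorder} composition" and p i j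
  assume "\<not> weakly_decreasing \<alpha>" "p = chosen_ascent \<alpha>" "(i, j) = p"
  then have "ascent \<alpha> i j" using chosen_ascent[of \<alpha>] by (metis fst_conv snd_conv)
  then show "(interchange i j \<alpha>, \<alpha>) \<in> Wellfounded.measure (\<lambda>\<alpha>. card (strict_rises \<alpha>))"
    by (simp add: strict_rises_interchange)
qed simp

declare key_poly.simps [simp del]


subsection \<open>Newton polytopes and the order on compositions\<close>

definition newton :: "('n::finite, 'a::zero) mpolynomial \<Rightarrow> (real ^ 'n) set" where
  "newton f = convex hull ((\<lambda>\<gamma>. \<chi> i. real (entry \<gamma> i)) ` Poly_Mapping.keys f)"

text \<open>
  \<open>kappa_move \<gamma> \<delta>\<close>: the composition \<open>\<gamma>\<close> is replaced by \<open>\<delta>\<close>. In the second rule \<open>\<gamma>\<^sub>j \<ge> 2\<close>, so the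
  truncated subtraction on \<^typ>\<open>nat\<close> is the true one.
\<close>

inductive kappa_move :: "'n::linorder composition \<Rightarrow> 'n composition \<Rightarrow> bool" where
  exchange: "i < j \<Longrightarrow> entry \<gamma> i < entry \<gamma> j \<Longrightarrow> kappa_move \<gamma> (interchange i j \<gamma>)"
| transfer: "i < j \<Longrightarrow> int (entry \<gamma> i) < int (entry \<gamma> j) - 1 \<Longrightarrow>
    kappa_move \<gamma> (\<gamma> + unit_vec i - unit_vec j)"

definition kappa_le :: "'n::linorder composition \<Rightarrow> 'n composition \<Rightarrow> bool"
    (infix \<open>\<le>\<^sub>\<kappa>\<close> 50) where
  "\<beta> \<le>\<^sub>\<kappa> \<alpha> \<longleftrightarrow> kappa_move\<^sup>*\<^sup>* \<alpha> \<beta>"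


subsection \<open>Well-definedness\<close>

lemma interchange_interchange [simp]: "interchange i j (interchange i j \<gamma>) = \<gamma>"
  by (rule poly_mapping_eqI) simp

lemma inj_interchange [simp]: "inj (interchange i j)"
  by (metis injI interchange_interchange)

lemma interchange_add: "interchange i j (\<gamma> + \<delta>) = interchange i j \<gamma> + interchange i j \<delta>"
  by (rule poly_mapping_eqI) (simp add: lookup_add)

lemma interchange_0 [simp]: "interchange i j 0 = 0"
  by (rule poly_mapping_eqI) simp

lemma interchange_single [simp]:
  "interchange i j (Poly_Mapping.single k m) = Poly_Mapping.single (Transposition.transpose i j k) m"
  by (rule poly_mapping_eqI) (auto simp: lookup_single when_def Transposition.transpose_def)

lemma lookup_exchange_vars:
  "Poly_Mapping.lookup (exchange_vars i j f) \<gamma> = Poly_Mapping.lookup f (interchange i j \<gamma>)"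
  by (simp add: exchange_vars_def map_key.rep_eq)

lemma exchange_vars_single [simp]:
  "exchange_vars i j (Poly_Mapping.single \<gamma> c) = Poly_Mapping.single (interchange i j \<gamma>) c"
  by (rule poly_mapping_eqI) (auto simp: lookup_exchange_vars lookup_single when_def)

lemma exchange_vars_add: "exchange_vars i j (f + g) = exchange_vars i j f + exchange_vars i j g"
  by (rule poly_mapping_eqI) (simp add: lookup_exchange_vars lookup_add)

lemma exchange_vars_diff:
  fixes f g :: "('n, int) mpolynomial"
  shows "exchange_vars i j (f - g) = exchange_vars i j f - exchange_vars i j g"
  by (rule poly_mapping_eqI) (simp add: lookup_exchange_vars lookup_minus)

lemma exchange_vars_0 [simp]: "exchange_vars i j 0 = 0"
  by (rule poly_mapping_eqI) (simp add: lookup_exchange_vars)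

lemma poly_mapping_sum_induct [case_names zero add]:
  fixes f :: "'b \<Rightarrow>\<^sub>0 'c::monoid_add"
  assumes "P 0" and "\<And>f a b. P f \<Longrightarrow> P (f + Poly_Mapping.single a b)"
  shows "P f"
proof (induction f rule: update_induct)
  case (update f a b)
  have "Poly_Mapping.update a b f = f + Poly_Mapping.single a b"
    using update.hyps(1)
    by (intro poly_mapping_eqI)
      (auto simp: lookup_update lookup_add lookup_single when_def in_keys_iff)
  with update.IH assms(2) show ?case by simp
qed (rule assms(1))

lemma exchange_vars_mult:
  fixes f g :: "('n, int) mpolynomial"
  shows "exchange_vars i j (f * g) = exchange_vars i j f * exchange_vars i j g"
proof (induction f rule: poly_mapping_sum_induct)
  case (add f a b)
  have "exchange_vars i j (Poly_Mapping.single a b * g)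
      = Poly_Mapping.single (interchange i j a) b * exchange_vars i j g"
    by (induction g rule: poly_mapping_sum_induct)
      (simp_all add: distrib_left exchange_vars_add mult_single interchange_add)
  with add show ?case by (simp add: distrib_right exchange_vars_add)
qed simp

lemma exchange_vars_exchange_vars [simp]: "exchange_vars i j (exchange_vars i j f) = f"
  by (rule poly_mapping_eqI) (simp add: lookup_exchange_vars)

lemma exchange_vars_braid:
  assumes "i \<noteq> j" "j \<noteq> k" "i \<noteq> k"
  shows "exchange_vars i j (exchange_vars j k (exchange_vars i j f))
    = exchange_vars j k (exchange_vars i j (exchange_vars j k f))"
proof -
  have "interchange i j (interchange j k (interchange i j \<gamma>))
      = interchange j k (interchange i j (interchange j k \<gamma>))" for \<gamma>
    by (rule poly_mapping_eqI) (use assms in \<open>simp add: Transposition.transpose_def\<close>)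
  then show ?thesis by (intro poly_mapping_eqI) (simp add: lookup_exchange_vars)
qed

lemma interchange_commute:
  assumes "{i, j} \<inter> {k, l} = {}"
  shows "interchange i j (interchange k l \<gamma>) = interchange k l (interchange i j \<gamma>)"
  by (rule poly_mapping_eqI) (use assms in \<open>auto simp: Transposition.transpose_def\<close>)

lemma exchange_vars_commute:
  assumes "{i, j} \<inter> {k, l} = {}"
  shows "exchange_vars i j (exchange_vars k l f) = exchange_vars k l (exchange_vars i j f)"
  by (intro poly_mapping_eqI) (simp add: lookup_exchange_vars interchange_commute[OF assms])

lemma var_diff_nonzero:
  assumes "i \<noteq> j"
  shows "var i - var j \<noteq> (0 :: ('n, int) mpolynomial)"
proof
  assume "var i - var j = (0 :: ('n, int) mpolynomial)"
  then have "Poly_Mapping.lookup (var i - var j :: ('n, int) mpolynomial) (unit_vec i) = 0"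
    by simp
  moreover have "unit_vec i \<noteq> unit_vec j"
    using assms by (metis lookup_single_eq lookup_single_not_eq zero_neq_one)
  ultimately show False by (simp add: lookup_minus lookup_single)
qed

lemma var_diff_dvd:
  fixes f :: "('n::linorder, int) mpolynomial"
  shows "var i - var j dvd f - exchange_vars i j f"
proof -
  define P :: "('n, int) mpolynomial \<Rightarrow> bool"
    where "P f \<longleftrightarrow> var i - var j dvd f - exchange_vars i j f" for f
  have P_add: "P (f + g)" if "P f" "P g" for f g
  proof -
    have "f + g - exchange_vars i j (f + g) = (f - exchange_vars i j f) + (g - exchange_vars i j g)"
      by (simp add: exchange_vars_add)
    with that show ?thesis unfolding P_def by (metis dvd_add)
  qed
  have P_mult: "P (f * g)" if "P f" "P g" for f g
  proof -
    have "f * g - exchange_vars i j (f * g)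
        = f * (g - exchange_vars i j g) + (f - exchange_vars i j f) * exchange_vars i j g"
      by (simp add: exchange_vars_mult algebra_simps)
    with that show ?thesis unfolding P_def by (metis dvd_add dvd_mult dvd_mult2)
  qed
  have P_const: "P (Poly_Mapping.single 0 c)" for c
    by (simp add: P_def)
  have P_var: "P (var k)" for k
  proof -
    have "var j - var i = - (var i - var j :: ('n, int) mpolynomial)" by simp
    then have "var i - var j dvd (var j - var i :: ('n, int) mpolynomial)"
      by (metis dvd_minus_iff dvd_refl)
    then show ?thesis by (auto simp: P_def Transposition.transpose_def)
  qed
  have P_pow: "P (monomial (Poly_Mapping.single k m))" for k m
  proof (induction m)
    case (Suc m)
    have "monomial (Poly_Mapping.single k (Suc m))
        = var k * (monomial (Poly_Mapping.single k m) :: ('n, int) mpolynomial)"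
      by (simp add: mult_single flip: single_add)
    with P_mult[OF P_var Suc] show ?case by simp
  qed (use P_const[of 1] in simp)
  have P_mono: "P (monomial \<gamma>)" for \<gamma>
  proof (induction \<gamma> rule: poly_mapping_sum_induct)
    case (add \<gamma> k m)
    have "monomial (\<gamma> + Poly_Mapping.single k m)
        = monomial \<gamma> * (monomial (Poly_Mapping.single k m) :: ('n, int) mpolynomial)"
      by (simp add: mult_single)
    with P_mult[OF add P_pow] show ?case by simp
  qed (use P_const[of 1] in simp)
  have "P (Poly_Mapping.single \<gamma> c)" for \<gamma> c
    using P_mult[OF P_const[of c] P_mono[of \<gamma>]] by (simp add: mult_single)
  then have "P f"
    by (induction f rule: poly_mapping_sum_induct) (use P_const[of 0] P_add in auto)
  then show ?thesis by (simp add: P_def)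
qed

lemma divided_difference_eqI:
  assumes "i \<noteq> j" "g * (var i - var j) = f - exchange_vars i j f"
  shows "divided_difference i j f = g"
  unfolding divided_difference_def
proof (rule the_equality)
  fix h assume "h * (var i - var j) = f - exchange_vars i j f"
  with assms(2) have "h * (var i - var j) = g * (var i - var j)" by simp
  then show "h = g" using var_diff_nonzero[OF assms(1)] by simp
qed (rule assms(2))

lemma divided_difference_mult:
  assumes "i \<noteq> j"
  shows "divided_difference i j f * (var i - var j) = f - exchange_vars i j f"
proof -
  obtain g where "f - exchange_vars i j f = (var i - var j) * g"
    using var_diff_dvd[of i j f] by (auto elim: dvdE)
  then have "g * (var i - var j) = f - exchange_vars i j f"
    by (simp add: mult.commute)
  with divided_difference_eqI[OF assms] show ?thesis by metis
qed

lemma demazure_mult: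
  assumes "i \<noteq> j"
  shows "demazure i j f * (var i - var j) = var i * f - var j * exchange_vars i j f"
  unfolding demazure_def divided_difference_mult[OF assms] exchange_vars_mult by simp

lemma demazure_eqI:
  assumes "i \<noteq> j" "g * (var i - var j) = var i * f - var j * exchange_vars i j f"
  shows "demazure i j f = g"
proof -
  have "demazure i j f * (var i - var j) = g * (var i - var j)"
    using demazure_mult[OF assms(1)] assms(2) by simp
  then show ?thesis using var_diff_nonzero[OF assms(1)] by simp
qed

lemma exchange_vars_var:
  "exchange_vars i j (var k) = (var (Transposition.transpose i j k) :: ('n, int) mpolynomial)"
  by simp

lemma demazure_symmetric:
  assumes "i \<noteq> j"
  shows "exchange_vars i j (demazure i j f) = demazure i j f"
proof -
  have "exchange_vars i j (demazure i j f * (var i - var j))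
      = exchange_vars i j (var i * f - var j * exchange_vars i j f)"
    by (simp only: demazure_mult[OF assms])
  then have "exchange_vars i j (demazure i j f) * (var j - var i)
      = var j * exchange_vars i j f - var i * f"
    by (simp only: exchange_vars_mult exchange_vars_diff exchange_vars_var
        exchange_vars_exchange_vars transpose_apply_first transpose_apply_second)
  then have "exchange_vars i j (demazure i j f) * (var i - var j)
      = var i * f - var j * exchange_vars i j f"
    by algebra
  from demazure_eqI[OF assms this] show ?thesis by simp
qed

lemma exchange_vars_demazure:
  assumes "k \<noteq> l"
  shows "exchange_vars i j (demazure k l f)
      * (var (Transposition.transpose i j k) - var (Transposition.transpose i j l))
    = var (Transposition.transpose i j k) * exchange_vars i j f
      - var (Transposition.transpose i j l) * exchange_vars i j (exchange_vars k l f)"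
  using arg_cong[OF demazure_mult[OF assms], of "exchange_vars i j" f]
  by (simp only: exchange_vars_mult exchange_vars_diff exchange_vars_var)

lemma demazure_commute:
  assumes "i \<noteq> j" "k \<noteq> l" "{i, j} \<inter> {k, l} = {}"
  shows "demazure i j (demazure k l f) = demazure k l (demazure i j f)"
proof -
  have t: "Transposition.transpose i j k = k" "Transposition.transpose i j l = l"
    "Transposition.transpose k l i = i" "Transposition.transpose k l j = j"
    using assms(3) by (auto simp: Transposition.transpose_def)
  note 1 = demazure_mult[OF assms(1), of "demazure k l f"] demazure_mult[OF assms(2), of f]
    exchange_vars_demazure[OF assms(2), of i j f, unfolded t]
  note 2 = demazure_mult[OF assms(2), of "demazure i j f"] demazure_mult[OF assms(1), of f]
    exchange_vars_demazure[OF assms(1), of k l f, unfolded t exchange_vars_commute[OF assms(3), symmetric]]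
  have "demazure i j (demazure k l f) * ((var i - var j) * (var k - var l))
      = demazure k l (demazure i j f) * ((var i - var j) * (var k - var l))"
    using 1 2 by algebra
  moreover have "(var i - var j) * (var k - var l) \<noteq> (0 :: ('a, int) mpolynomial)"
    using var_diff_nonzero[OF assms(1)] var_diff_nonzero[OF assms(2)] by simp
  ultimately show ?thesis by simp
qed

lemma demazure_braid_expand:
  fixes f :: "('n::linorder, int) mpolynomial"
  assumes "i \<noteq> j" "j \<noteq> k" "i \<noteq> k"
  shows "demazure i j (demazure j k (demazure i j f))
      * ((var i - var j) * (var j - var k) * (var i - var k))
    = var i * var i * var j * f
      - var i * var j * var j * exchange_vars i j f
      - var i * var i * var k * exchange_vars j k f
      + var i * var k * var k * exchange_vars j k (exchange_vars i j f)
      + var j * var j * var k * exchange_vars i j (exchange_vars j k f)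
      - var j * var k * var k * exchange_vars i j (exchange_vars j k (exchange_vars i j f))"
    (is "?c * _ = ?rhs")
proof -
  define a where "a = demazure i j f"
  define b where "b = demazure j k a"
  have t: "Transposition.transpose i j i = j" "Transposition.transpose i j j = i"
    "Transposition.transpose i j k = k" "Transposition.transpose j k i = i"
    "Transposition.transpose j k j = k" "Transposition.transpose j k k = j"
    using assms by (auto simp: Transposition.transpose_def)
  have 1: "a * (var i - var j) = var i * f - var j * exchange_vars i j f"
    unfolding a_def by (rule demazure_mult[OF assms(1)])
  have 2: "b * (var j - var k) = var j * a - var k * exchange_vars j k a"
    unfolding b_def by (rule demazure_mult[OF assms(2)])
  have 3: "?c * (var i - var j) = var i * b - var j * exchange_vars i j b"
    unfolding b_def a_def by (rule demazure_mult[OF assms(1)])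
  have 4: "exchange_vars j k a * (var i - var k)
      = var i * exchange_vars j k f - var k * exchange_vars j k (exchange_vars i j f)"
    unfolding a_def using exchange_vars_demazure[OF assms(1), of j k f] unfolding t .
  have 5: "exchange_vars i j b * (var i - var k)
      = var i * a - var k * exchange_vars i j (exchange_vars j k a)"
    unfolding b_def using exchange_vars_demazure[OF assms(2), of i j a] unfolding t
    unfolding a_def demazure_symmetric[OF assms(1)] .
  have 6: "exchange_vars i j (exchange_vars j k a) * (var j - var k)
      = var j * exchange_vars i j (exchange_vars j k f)
        - var k * exchange_vars i j (exchange_vars j k (exchange_vars i j f))"
    using arg_cong[OF 4, of "exchange_vars i j"]
    by (simp only: exchange_vars_mult exchange_vars_diff exchange_vars_var t)
  have "?c * ((var i - var j) * (var j - var k) * (var i - var k)) * (var i - var j)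
      = ?rhs * (var i - var j)"
    using 1 2 3 4 5 6 by algebra
  with var_diff_nonzero[OF assms(1)] show ?thesis by simp
qed


lemma demazure_braid_expand':
  fixes f :: "('n::linorder, int) mpolynomial"
  assumes "i \<noteq> j" "j \<noteq> k" "i \<noteq> k"
  shows "demazure j k (demazure i j (demazure j k f))
      * ((var i - var j) * (var j - var k) * (var i - var k))
    = var i * var i * var j * f
      - var i * var j * var j * exchange_vars i j f
      - var i * var i * var k * exchange_vars j k f
      + var i * var k * var k * exchange_vars j k (exchange_vars i j f)
      + var j * var j * var k * exchange_vars i j (exchange_vars j k f)
      - var j * var k * var k * exchange_vars i j (exchange_vars j k (exchange_vars i j f))"
    (is "?c * _ = ?rhs")
proof -
  define a where "a = demazure j k f"
  define b where "b = demazure i j a"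
  have t: "Transposition.transpose i j i = j" "Transposition.transpose i j j = i"
    "Transposition.transpose i j k = k" "Transposition.transpose j k i = i"
    "Transposition.transpose j k j = k" "Transposition.transpose j k k = j"
    using assms by (auto simp: Transposition.transpose_def)
  have 1: "a * (var j - var k) = var j * f - var k * exchange_vars j k f"
    unfolding a_def by (rule demazure_mult[OF assms(2)])
  have 2: "b * (var i - var j) = var i * a - var j * exchange_vars i j a"
    unfolding b_def by (rule demazure_mult[OF assms(1)])
  have 3: "?c * (var j - var k) = var j * b - var k * exchange_vars j k b"
    unfolding b_def a_def by (rule demazure_mult[OF assms(2)])
  have 4: "exchange_vars i j a * (var i - var k)
      = var i * exchange_vars i j f - var k * exchange_vars i j (exchange_vars j k f)"
    unfolding a_def using exchange_vars_demazure[OF assms(2), of i j f] unfolding t .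
  have 5: "exchange_vars j k b * (var i - var k)
      = var i * a - var k * exchange_vars j k (exchange_vars i j a)"
    unfolding b_def using exchange_vars_demazure[OF assms(1), of j k a] unfolding t
    unfolding a_def demazure_symmetric[OF assms(2)] .
  have 6: "exchange_vars j k (exchange_vars i j a) * (var i - var j)
      = var i * exchange_vars j k (exchange_vars i j f)
        - var j * exchange_vars i j (exchange_vars j k (exchange_vars i j f))"
    using arg_cong[OF 4, of "exchange_vars j k"]
    unfolding exchange_vars_braid[OF assms]
    by (simp only: exchange_vars_mult exchange_vars_diff exchange_vars_var t)
  have "?c * ((var i - var j) * (var j - var k) * (var i - var k)) * (var j - var k)
      = ?rhs * (var j - var k)"
    using 1 2 3 4 5 6 by algebra
  with var_diff_nonzero[OF assms(2)] show ?thesis by simp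
qed

lemma demazure_braid:
  assumes "i \<noteq> j" "j \<noteq> k" "i \<noteq> k"
  shows "demazure i j (demazure j k (demazure i j f)) = demazure j k (demazure i j (demazure j k f))"
proof -
  have "demazure i j (demazure j k (demazure i j f))
        * ((var i - var j) * (var j - var k) * (var i - var k))
      = demazure j k (demazure i j (demazure j k f))
        * ((var i - var j) * (var j - var k) * (var i - var k))"
    by (simp only: demazure_braid_expand[OF assms] demazure_braid_expand'[OF assms])
  moreover have "(var i - var j) * (var j - var k) * (var i - var k)
      \<noteq> (0 :: ('a, int) mpolynomial)"
    using assms var_diff_nonzero by (metis no_zero_divisors)
  ultimately show ?thesis by simp
qed

lemma not_weakly_decreasing_ascent: "ascent \<alpha> i j \<Longrightarrow> \<not> weakly_decreasing \<alpha>"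
  by (metis ascent_def consecutive_def leD less_imp_le weakly_decreasing_def)

theorem key_poly_ascent:
  fixes \<alpha> :: "'n::{finite,linorder} composition"
  assumes "ascent \<alpha> i j"
  shows "key_poly \<alpha> = demazure i j (key_poly (interchange i j \<alpha>))"
  using assms
proof (induction "card (strict_rises \<alpha>)" arbitrary: \<alpha> i j rule: less_induct)
  case less
  have IH: "key_poly \<gamma> = demazure p q (key_poly (interchange p q \<gamma>))"
    if "card (strict_rises \<gamma>) < card (strict_rises \<alpha>)" "ascent \<gamma> p q" for \<gamma> :: "'n composition" and p q
    using less.hyps that by blast
  have triple: "demazure p q (key_poly (interchange p q \<alpha>))
      = demazure q r (key_poly (interchange q r \<alpha>))"
    if "ascent \<alpha> p q" "ascent \<alpha> q r" for p q r
  proof -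
    have c: "consecutive p q" "consecutive q r" "entry \<alpha> p < entry \<alpha> q" "entry \<alpha> q < entry \<alpha> r"
      using that by (auto simp: ascent_def)
    then have ne: "p \<noteq> q" "q \<noteq> r" "p \<noteq> r" by (auto simp: consecutive_def)
    have t: "Transposition.transpose p q p = q" "Transposition.transpose p q q = p"
      "Transposition.transpose p q r = r" "Transposition.transpose q r p = p"
      "Transposition.transpose q r q = r" "Transposition.transpose q r r = q"
      using ne by (auto simp: Transposition.transpose_def)
    define \<beta> where "\<beta> = interchange p q \<alpha>"
    define \<gamma> where "\<gamma> = interchange q r \<alpha>"
    have asc1: "ascent \<beta> q r" "ascent \<gamma> p q"
      and asc2: "ascent (interchange q r \<beta>) p q" "ascent (interchange p q \<gamma>) q r"
      using c by (auto simp: \<beta>_def \<gamma>_def ascent_def t)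
    have less1: "card (strict_rises \<beta>) < card (strict_rises \<alpha>)"
      "card (strict_rises \<gamma>) < card (strict_rises \<alpha>)"
      unfolding \<beta>_def \<gamma>_def by (rule strict_rises_interchange[OF that(1)] strict_rises_interchange[OF that(2)])+
    note less2 = less_trans[OF strict_rises_interchange[OF asc1(1)] less1(1)]
      less_trans[OF strict_rises_interchange[OF asc1(2)] less1(2)]
    have
      "key_poly \<beta> = demazure q r (demazure p q (key_poly (interchange p q (interchange q r \<beta>))))"
      "key_poly \<gamma> = demazure p q (demazure q r (key_poly (interchange q r (interchange p q \<gamma>))))"
      using IH[OF less1(1) asc1(1)] IH[OF less1(2) asc1(2)] IH[OF less2(1) asc2(1)]
        IH[OF less2(2) asc2(2)] by argo+
    moreover have "interchange p q (interchange q r \<beta>) = interchange q r (interchange p q \<gamma>)"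
      unfolding \<beta>_def \<gamma>_def
      by (rule poly_mapping_eqI) (use ne in \<open>simp add: Transposition.transpose_def\<close>)
    ultimately show ?thesis
      unfolding \<beta>_def[symmetric] \<gamma>_def[symmetric] by (simp add: demazure_braid[OF ne])
  qed
  obtain k l where kl: "chosen_ascent \<alpha> = (k, l)" by fastforce
  note nwd = not_weakly_decreasing_ascent[OF less.prems]
  have asc: "ascent \<alpha> k l" using chosen_ascent[OF nwd] kl by simp
  have eq: "key_poly \<alpha> = demazure k l (key_poly (interchange k l \<alpha>))"
    by (subst key_poly.simps) (simp add: nwd kl)
  have c: "consecutive i j" "consecutive k l"
    using less.prems asc by (auto simp: ascent_def)
  then have ne: "i \<noteq> j" "k \<noteq> l" by (auto simp: consecutive_def)
  consider "i = k" | "j = l" | "j = k" | "l = i" | "{i, j} \<inter> {k, l} = {}" by auto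
  then show ?case
  proof cases
    case 1
    with c have "j = l" by (auto simp: consecutive_def) (metis linorder_neqE)
    with 1 eq show ?thesis by simp
  next
    case 2
    with c have "i = k" by (auto simp: consecutive_def) (metis linorder_neqE)
    with 2 eq show ?thesis by simp
  next
    case 3
    with triple[of i j l] less.prems asc eq show ?thesis by simp
  next
    case 4
    with triple[of k i j] less.prems asc eq show ?thesis by simp
  next
    case 5
    have t: "Transposition.transpose i j k = k" "Transposition.transpose i j l = l"
      "Transposition.transpose k l i = i" "Transposition.transpose k l j = j"
      using 5 by (auto simp: Transposition.transpose_def)
    have "ascent (interchange k l \<alpha>) i j" "ascent (interchange i j \<alpha>) k l"
      using less.prems asc by (auto simp: ascent_def t)
    then have "key_poly (interchange k l \<alpha>)
        = demazure i j (key_poly (interchange i j (interchange k l \<alpha>)))"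
      "key_poly (interchange i j \<alpha>)
        = demazure k l (key_poly (interchange k l (interchange i j \<alpha>)))"
      using IH strict_rises_interchange[OF less.prems] strict_rises_interchange[OF asc] by auto
    then show ?thesis
      by (simp add: eq interchange_commute[OF 5] demazure_commute[OF ne 5])
  qed
qed

end

theory Submission
  imports Defs
begin

text \<open>
  The Newton polytope of \<open>\<kappa>\<^sub>\<alpha>\<close> is a sum of Schubert matroid polytopes, one for each level set
  \<open>{k. \<alpha>\<^sub>k > l}\<close>, so it is cut out by the inequalities \<open>\<Sum>\<^bsub>k\<in>I\<^esub> x\<^sub>k \<le> f\<^sub>\<alpha>(I)\<close> with \<open>f\<^sub>\<alpha>\<close> the integral
  submodular sum of the matroid ranks. Its lattice points form \<open>schubitope \<alpha>\<close>. If
  \<open>\<alpha>\<^sub>i < \<alpha>\<^sub>i\<^sub>+\<^sub>1\<close> and \<open>\<alpha>' = s\<^sub>i\<alpha>\<close>, submodularity shows that every point of \<open>schubitope \<alpha>\<close> lies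
  between some \<open>\<delta> \<in> schubitope \<alpha>'\<close> with \<open>\<delta>\<^sub>i \<ge> \<delta>\<^sub>i\<^sub>+\<^sub>1\<close> and \<open>s\<^sub>i\<delta>\<close>. By induction from the weakly
  decreasing case, \<open>schubitope \<alpha>\<close> is the set of all \<open>\<gamma> \<le>\<^sub>\<kappa> \<alpha>\<close>, it contains the support of
  \<open>\<kappa>\<^sub>\<alpha>\<close>, and it lies in the convex hull of its points of the same Euclidean length as \<open>\<alpha>\<close>,
  which are its longest points. At those points no cancellation can occur in \<open>\<pi>\<^sub>i\<close>, so they lie
  in the support of \<open>\<kappa>\<^sub>\<alpha>\<close>.
\<close>

section \<open>Ranks of Schubert matroids\<close>

definition upset :: "'n::linorder set \<Rightarrow> bool" where
  "upset K \<longleftrightarrow> (\<forall>a\<in>K. \<forall>b. a \<le> b \<longrightarrow> b \<in> K)"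

lemma upset_total: "upset K \<Longrightarrow> upset L \<Longrightarrow> K \<subseteq> L \<or> L \<subseteq> K"
  unfolding upset_def by (metis linear subsetI)

lemma upset_less: "upset K \<Longrightarrow> i < j \<Longrightarrow> i \<in> K \<Longrightarrow> j \<in> K"
  unfolding upset_def by (meson less_imp_le)

text \<open>Used to repair a minimizing upper set that separates \<open>i\<close> from
  \<open>j\<close>: add \<open>i\<close>, or drop \<open>j\<close> as in the next lemma. Nothing
  lies strictly between the two indices, so the result is still an upper set.\<close>

lemma upset_insert_consecutive:
  assumes "upset K" "consecutive i j" "j \<in> K"
  shows "upset (insert i K)"
  unfolding upset_def
proof (intro ballI allI impI)
  fix a b assume ab: "a \<in> insert i K" "a \<le> b"
  show "b \<in> insert i K"
  proof (cases "a \<in> K")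
    case True
    with ab assms(1) show ?thesis by (auto simp: upset_def)
  next
    case False
    with ab have "b = i \<or> i < b" by auto
    then have "b = i \<or> j \<le> b" using assms(2) unfolding consecutive_def by (meson not_less)
    then show ?thesis using assms(1,3) by (auto simp: upset_def)
  qed
qed

lemma upset_remove_consecutive:
  assumes "upset K" "consecutive i j" "i \<notin> K"
  shows "upset (K - {j})"
  unfolding upset_def
proof (intro ballI allI impI)
  fix a b assume ab: "a \<in> K - {j}" "a \<le> b"
  have "b \<noteq> j"
  proof
    assume "b = j"
    with ab have "a < j" by auto
    then have "a \<le> i" using assms(2) by (auto simp: consecutive_def not_less)
    with ab assms(1,3) show False by (auto simp: upset_def)
  qed
  with ab assms(1) show "b \<in> K - {j}" by (auto simp: upset_def)
qed

text \<open>
  The largest size of a subset of \<open>I\<close> that can be matched into \<open>R\<close> so that every element is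
  matched with a weakly larger one, by Hall's theorem.
\<close>

definition schubert_rank :: "'n::{finite,linorder} set \<Rightarrow> 'n set \<Rightarrow> nat" where
  "schubert_rank R I = Min ((\<lambda>K. card (I - K) + card (R \<inter> K)) ` Collect upset)"

lemma schubert_rank_le: "upset K \<Longrightarrow> schubert_rank R I \<le> card (I - K) + card (R \<inter> K)"
  unfolding schubert_rank_def by (intro Min_le) auto

lemma schubert_rank_attained:
  obtains K where "upset K" "schubert_rank R I = card (I - K) + card (R \<inter> K)"
proof -
  have "upset {}" by (simp add: upset_def)
  then have "schubert_rank R I \<in> (\<lambda>K. card (I - K) + card (R \<inter> K)) ` Collect upset"
    unfolding schubert_rank_def by (intro Min_in) auto
  then show ?thesis using that by auto
qed

lemma card_Int_le_schubert_rank: "card (R \<inter> I) \<le> schubert_rank R I"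
proof -
  obtain K where K: "schubert_rank R I = card (I - K) + card (R \<inter> K)"
    using schubert_rank_attained .
  have "card (R \<inter> I) \<le> card ((I - K) \<union> (R \<inter> K))" by (intro card_mono) auto
  also have "\<dots> \<le> card (I - K) + card (R \<inter> K)" by (rule card_Un_le)
  finally show ?thesis using K by simp
qed

lemma schubert_rank_mono: "I \<subseteq> J \<Longrightarrow> schubert_rank R I \<le> schubert_rank R J"
proof -
  assume "I \<subseteq> J"
  obtain K where K: "upset K" "schubert_rank R J = card (J - K) + card (R \<inter> K)"
    using schubert_rank_attained .
  have "card (I - K) \<le> card (J - K)" using \<open>I \<subseteq> J\<close> by (intro card_mono) auto
  with K schubert_rank_le[OF K(1), of R I] show ?thesis by simp
qed

text \<open>Minimizers \<open>K\<close> for \<open>I\<close> and \<open>L\<close> for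
  \<open>J\<close> are nested, being upper sets of a chain. The larger one is a candidate for
  \<open>I \<union> J\<close>, the smaller one for \<open>I \<inter> J\<close>, and the
  contributions of \<open>R\<close> agree on both sides.\<close>

lemma schubert_rank_submodular:
  "schubert_rank R (I \<union> J) + schubert_rank R (I \<inter> J) \<le> schubert_rank R I + schubert_rank R J"
proof -
  obtain K where K: "upset K" "schubert_rank R I = card (I - K) + card (R \<inter> K)"
    using schubert_rank_attained .
  obtain L where L: "upset L" "schubert_rank R J = card (J - L) + card (R \<inter> L)"
    using schubert_rank_attained .
  have *: "card (A \<union> B - L) + card (A \<inter> B - K) \<le> card (A - K) + card (B - L)"
    if "K \<subseteq> L" for A B K L :: "'a set"
  proof -
    \<comment> \<open>\<open>X\<close> is what \<open>A \<inter> B - K\<close> has beyond the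
      intersection of \<open>A - K\<close> and \<open>B - L\<close>. Together with
      \<open>A \<union> B - L\<close>, from which it is disjoint, it fits into their union.\<close>
    define X where "X = A \<inter> B \<inter> (L - K)"
    have 1: "card (A \<inter> B - K) = card ((A - K) \<inter> (B - L)) + card X"
    proof -
      have "A \<inter> B - K = (A - K) \<inter> (B - L) \<union> X" unfolding X_def using that by auto
      then show ?thesis by (simp add: X_def card_Un_disjoint disjoint_iff)
    qed
    have "card (A \<union> B - L) + card X = card ((A \<union> B - L) \<union> X)"
      by (rule card_Un_disjoint[symmetric]) (auto simp: X_def)
    also have "\<dots> \<le> card ((A - K) \<union> (B - L))"
      unfolding X_def by (intro card_mono) (use that in auto)
    finally show ?thesis
      using 1 card_Un_Int[of "A - K" "B - L"] by simp
  qed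
  from upset_total[OF K(1) L(1)] show ?thesis
  proof
    assume "K \<subseteq> L"
    from *[OF this, of I J] schubert_rank_le[OF L(1), of R "I \<union> J"]
      schubert_rank_le[OF K(1), of R "I \<inter> J"] K(2) L(2)
    show ?thesis by linarith
  next
    assume "L \<subseteq> K"
    from *[OF this, of J I] schubert_rank_le[OF K(1), of R "I \<union> J"]
      schubert_rank_le[OF L(1), of R "I \<inter> J"] K(2) L(2)
    show ?thesis by (simp add: Un_commute Int_commute)
  qed
qed

section \<open>Ranks when an index is replaced in \<open>I\<close> or in \<open>R\<close>\<close>

lemma card_swap_minus_upset_le:
  fixes I :: "'n::{finite,linorder} set"
  assumes "upset K" "i < j" "i \<in> I" "j \<notin> I"
  shows "card (insert j (I - {i}) - K) \<le> card (I - K)"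
proof (cases "i \<in> K")
  case True
  then have "insert j (I - {i}) - K \<subseteq> I - K"
    using upset_less[OF assms(1,2)] by auto
  then show ?thesis by (intro card_mono) auto
next
  case False
  have "insert j (I - {i}) - K \<subseteq> insert j ((I - K) - {i})" by auto
  then have "card (insert j (I - {i}) - K) \<le> card (insert j ((I - K) - {i}))"
    by (intro card_mono) auto
  also have "\<dots> = Suc (card ((I - K) - {i}))" using assms by simp
  also have "\<dots> = card (I - K)" using False assms by (intro card_Suc_Diff1) auto
  finally show ?thesis .
qed

lemma card_Int_upset_swap_le:
  fixes R :: "'n::{finite,linorder} set"
  assumes "upset K" "i < j" "i \<notin> R" "j \<in> R"
  shows "card (insert i (R - {j}) \<inter> K) \<le> card (R \<inter> K)"
proof (cases "j \<in> K")
  case True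
  have "insert i (R - {j}) \<inter> K \<subseteq> insert i ((R \<inter> K) - {j})" by auto
  then have "card (insert i (R - {j}) \<inter> K) \<le> card (insert i ((R \<inter> K) - {j}))"
    by (intro card_mono) auto
  also have "\<dots> = Suc (card ((R \<inter> K) - {j}))" using assms by simp
  also have "\<dots> = card (R \<inter> K)" using True assms by (intro card_Suc_Diff1) auto
  finally show ?thesis .
next
  case False
  then have "insert i (R - {j}) \<inter> K \<subseteq> R \<inter> K"
    using upset_less[OF assms(1,2)] by auto
  then show ?thesis by (intro card_mono) auto
qed

lemma schubert_rank_swap_ground_le:
  assumes "i < j" "i \<in> I" "j \<notin> I"
  shows "schubert_rank R (insert j (I - {i})) \<le> schubert_rank R I"
proof -
  obtain K where K: "upset K" "schubert_rank R I = card (I - K) + card (R \<inter> K)"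
    using schubert_rank_attained .
  from schubert_rank_le[OF K(1), of R "insert j (I - {i})"] card_swap_minus_upset_le[OF K(1) assms] K(2)
  show ?thesis by simp
qed

lemma schubert_rank_swap_le:
  assumes "i < j" "i \<notin> R" "j \<in> R"
  shows "schubert_rank (insert i (R - {j})) I \<le> schubert_rank R I"
proof -
  obtain K where K: "upset K" "schubert_rank R I = card (I - K) + card (R \<inter> K)"
    using schubert_rank_attained .
  from schubert_rank_le[OF K(1), of "insert i (R - {j})" I] card_Int_upset_swap_le[OF K(1) assms] K(2)
  show ?thesis by simp
qed

text \<open>Only a minimizer with \<open>i \<notin> K\<close> and \<open>j \<in> K\<close> needs
  work. If \<open>j \<in> R\<close>, dropping \<open>j\<close> from \<open>K\<close> trades one
  element of \<open>R\<close> for one of \<open>I\<close>; otherwise \<open>i \<notin> R\<close>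
  too, and adding \<open>i\<close> to \<open>K\<close> leaves \<open>R \<inter> K\<close>
  unchanged.\<close>

lemma schubert_rank_swap_ground_eq:
  assumes "consecutive i j" "i \<in> R \<Longrightarrow> j \<in> R" "i \<in> I" "j \<notin> I"
  shows "schubert_rank R (insert j (I - {i})) = schubert_rank R I"
proof (rule antisym)
  have "i < j" using assms(1) by (simp add: consecutive_def)
  then show "schubert_rank R (insert j (I - {i})) \<le> schubert_rank R I"
    using assms by (intro schubert_rank_swap_ground_le)
  obtain K where K: "upset K"
    "schubert_rank R (insert j (I - {i})) = card (insert j (I - {i}) - K) + card (R \<inter> K)"
    using schubert_rank_attained .
  consider "i \<in> K" "j \<in> K" | "i \<notin> K" "j \<notin> K" | "i \<notin> K" "j \<in> K"
    using upset_less[OF K(1) \<open>i < j\<close>] by blast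
  then show "schubert_rank R I \<le> schubert_rank R (insert j (I - {i}))"
  proof cases
    case 1
    then have "insert j (I - {i}) - K = I - K" by auto
    with K schubert_rank_le[OF K(1), of R I] show ?thesis by simp
  next
    case 2
    then have "insert j (I - {i}) - K = insert j ((I - K) - {i})" by auto
    then have "card (insert j (I - {i}) - K) = Suc (card ((I - K) - {i}))" using assms by simp
    also have "\<dots> = card (I - K)" using 2 assms by (intro card_Suc_Diff1) auto
    finally show ?thesis using K schubert_rank_le[OF K(1), of R I] by simp
  next
    case 3
    have eq: "insert j (I - {i}) - K = I - insert i K" using 3 by auto
    show ?thesis
    proof (cases "j \<in> R")
      case True
      have "I - (K - {j}) = insert i (I - insert i K)" using assms 3 by auto
      then have "card (I - (K - {j})) = Suc (card (I - insert i K))" by simp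
      moreover have "Suc (card (R \<inter> (K - {j}))) = card (R \<inter> K)"
      proof -
        have "R \<inter> (K - {j}) = (R \<inter> K) - {j}" by auto
        then show ?thesis using True 3 by (simp add: card_Suc_Diff1 del: card_Diff_insert)
      qed
      ultimately show ?thesis
        using K eq schubert_rank_le[OF upset_remove_consecutive[OF K(1) assms(1) 3(1)], of R I] by simp
    next
      case False
      then have "R \<inter> insert i K = R \<inter> K" using assms by auto
      then show ?thesis
        using K eq schubert_rank_le[OF upset_insert_consecutive[OF K(1) assms(1) 3(2)], of R I] by simp
    qed
  qed
qed

text \<open>A separating minimizer is repaired by adding \<open>i\<close> if
  \<open>i \<in> I\<close>, and by dropping \<open>j\<close> if neither index is in
  \<open>I\<close>. The rank can drop only on the excluded sets, those with \<open>j\<close> but not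
  \<open>i\<close>.\<close>

lemma schubert_rank_swap_eq:
  assumes "consecutive i j" "i \<notin> R" "j \<in> R" "i \<in> I \<or> j \<notin> I"
  shows "schubert_rank (insert i (R - {j})) I = schubert_rank R I"
proof (rule antisym)
  have "i < j" using assms(1) by (simp add: consecutive_def)
  then show "schubert_rank (insert i (R - {j})) I \<le> schubert_rank R I"
    using assms by (intro schubert_rank_swap_le)
  obtain K where K: "upset K"
    "schubert_rank (insert i (R - {j})) I = card (I - K) + card (insert i (R - {j}) \<inter> K)"
    using schubert_rank_attained .
  consider "i \<in> K" "j \<in> K" | "i \<notin> K" "j \<notin> K" | "i \<notin> K" "j \<in> K"
    using upset_less[OF K(1) \<open>i < j\<close>] by blast
  then show "schubert_rank R I \<le> schubert_rank (insert i (R - {j})) I"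
  proof cases
    case 1
    then have "insert i (R - {j}) \<inter> K = insert i ((R \<inter> K) - {j})" by auto
    then have "card (insert i (R - {j}) \<inter> K) = Suc (card ((R \<inter> K) - {j}))" using assms by simp
    also have "\<dots> = card (R \<inter> K)" using 1 assms by (intro card_Suc_Diff1) auto
    finally show ?thesis using K schubert_rank_le[OF K(1), of R I] by simp
  next
    case 2
    then have "insert i (R - {j}) \<inter> K = R \<inter> K" by auto
    with K schubert_rank_le[OF K(1), of R I] show ?thesis by simp
  next
    case 3
    have eq: "insert i (R - {j}) \<inter> K = R \<inter> (K - {j})" using 3 by auto
    show ?thesis
    proof (cases "i \<in> I")
      case True
      have "I - insert i K = (I - K) - {i}" by auto
      then have "Suc (card (I - insert i K)) = card (I - K)"
        using True 3 by (simp add: card_Suc_Diff1 del: card_Diff_insert)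
      moreover have "R \<inter> insert i K = insert j (R \<inter> (K - {j}))" using assms 3 by auto
      then have "card (R \<inter> insert i K) = Suc (card (R \<inter> (K - {j})))" by simp
      ultimately show ?thesis
        using K eq schubert_rank_le[OF upset_insert_consecutive[OF K(1) assms(1) 3(2)], of R I] by simp
    next
      case False
      then have "I - (K - {j}) = I - K" using assms by auto
      then show ?thesis
        using K eq schubert_rank_le[OF upset_remove_consecutive[OF K(1) assms(1) 3(1)], of R I] by simp
    qed
  qed
qed


section \<open>Weights and capacities of compositions\<close>

definition wt :: "'n composition \<Rightarrow> 'n set \<Rightarrow> nat" where
  "wt \<gamma> I = (\<Sum>k\<in>I. entry \<gamma> k)"

definition level :: "'n composition \<Rightarrow> nat \<Rightarrow> 'n set" where
  "level \<alpha> l = {k. l < entry \<alpha> k}"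

text \<open>The bound \<open>wt \<alpha> UNIV\<close> is at least every entry, so the omitted levels
  are empty and have rank 0. It is invariant under \<open>interchange\<close>, which allows
  capacities to be compared term by term.\<close>

definition capacity :: "'n::{finite,linorder} composition \<Rightarrow> 'n set \<Rightarrow> nat" where
  "capacity \<alpha> I = (\<Sum>l<wt \<alpha> UNIV. schubert_rank (level \<alpha> l) I)"

lemma wt_remove: "k \<in> I \<Longrightarrow> wt \<gamma> I = entry \<gamma> k + wt \<gamma> (I - {k})" for I :: "'n::finite set"
  unfolding wt_def by (intro sum.remove) auto

lemma wt_split: "wt \<gamma> I = (if k \<in> I then entry \<gamma> k else 0) + wt \<gamma> (I - {k})" for I :: "'n::finite set"
  by (cases "k \<in> I") (simp_all flip: wt_remove)

lemma entry_le_wt: "k \<in> I \<Longrightarrow> entry \<gamma> k \<le> wt \<gamma> I" for I :: "'n::finite set"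
  by (simp add: wt_remove)

lemma wt_Un_Int: "wt \<gamma> (I \<union> J) + wt \<gamma> (I \<inter> J) = wt \<gamma> I + wt \<gamma> J" for I J :: "'n::finite set"
  unfolding wt_def by (intro sum.union_inter) auto

lemma wt_Compl: "wt \<gamma> I + wt \<gamma> (- I) = wt \<gamma> UNIV" for I :: "'n::finite set"
  using wt_Un_Int[of \<gamma> I "- I"] by (simp add: wt_def)

text \<open>Layer-cake counting: an entry is the number of levels containing its index. Weights can
  then be compared with capacities level by level.\<close>

lemma wt_eq_sum_levels:
  fixes \<alpha> :: "'n::finite composition"
  shows "wt \<alpha> I = (\<Sum>l<wt \<alpha> UNIV. card (level \<alpha> l \<inter> I))"
proof -
  have *: "entry \<alpha> k = (\<Sum>l<wt \<alpha> UNIV. if l < entry \<alpha> k then 1 else 0)" for k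
  proof -
    have "{..<wt \<alpha> UNIV} \<inter> {l. l < entry \<alpha> k} = {..<entry \<alpha> k}"
      using entry_le_wt[of k UNIV \<alpha>] by auto
    then show ?thesis by (subst sum.If_cases) auto
  qed
  have "wt \<alpha> I = (\<Sum>k\<in>I. \<Sum>l<wt \<alpha> UNIV. if l < entry \<alpha> k then 1 else 0)"
    unfolding wt_def[of \<alpha> I] by (intro sum.cong refl *)
  also have "\<dots> = (\<Sum>l<wt \<alpha> UNIV. \<Sum>k\<in>I. if l < entry \<alpha> k then 1 else 0)"
    by (rule sum.swap)
  also have "\<dots> = (\<Sum>l<wt \<alpha> UNIV. card (level \<alpha> l \<inter> I))"
    by (intro sum.cong refl) (simp add: sum.If_cases level_def Int_commute)
  finally show ?thesis .
qed

lemma wt_le_capacity: "wt \<alpha> I \<le> capacity \<alpha> I"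
  unfolding capacity_def wt_eq_sum_levels[of \<alpha> I]
  by (intro sum_mono card_Int_le_schubert_rank)

lemma capacity_mono: "I \<subseteq> J \<Longrightarrow> capacity \<alpha> I \<le> capacity \<alpha> J"
  unfolding capacity_def by (intro sum_mono schubert_rank_mono)

lemma capacity_submodular:
  "capacity \<alpha> (I \<union> J) + capacity \<alpha> (I \<inter> J) \<le> capacity \<alpha> I + capacity \<alpha> J"
  unfolding capacity_def sum.distrib[symmetric] by (intro sum_mono schubert_rank_submodular)

text \<open>\<open>K\<close> itself is a candidate in the minimum defining each rank. Hence the
  constraint of an upper set is tight at \<open>\<alpha>\<close>.\<close>

lemma capacity_upset_le: "upset K \<Longrightarrow> capacity \<alpha> K \<le> wt \<alpha> K"
  unfolding capacity_def wt_eq_sum_levels[of \<alpha> K]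
  by (intro sum_mono) (metis Diff_cancel add_0 card.empty schubert_rank_le)

text \<open>The levels of a weakly decreasing composition are initial segments, hence nested with
  \<open>- K\<close>. The candidate \<open>UNIV\<close> or the empty set then gives the
  bound.\<close>

lemma capacity_Compl_upset_le:
  assumes "weakly_decreasing \<alpha>" "upset K"
  shows "capacity \<alpha> (- K) \<le> wt \<alpha> (- K)"
  unfolding capacity_def wt_eq_sum_levels[of \<alpha> "- K"]
proof (intro sum_mono)
  fix l
  let ?R = "level \<alpha> l"
  have "upset (- ?R)"
    using assms(1) by (auto simp: upset_def level_def weakly_decreasing_def) (meson le_less_trans not_le)
  with upset_total[OF this assms(2)] consider "?R \<subseteq> - K" | "- K \<subseteq> ?R" by blast
  then show "schubert_rank ?R (- K) \<le> card (?R \<inter> - K)"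
  proof cases
    case 1
    then have "?R \<inter> - K = ?R" by auto
    with schubert_rank_le[of UNIV ?R "- K"] show ?thesis by (simp add: upset_def)
  next
    case 2
    then have "?R \<inter> - K = - K" by auto
    with schubert_rank_le[of "{}" ?R "- K"] show ?thesis by (simp add: upset_def)
  qed
qed

lemma capacity_swap_le:
  "i < j \<Longrightarrow> i \<in> I \<Longrightarrow> j \<notin> I \<Longrightarrow> capacity \<alpha> (insert j (I - {i})) \<le> capacity \<alpha> I"
  unfolding capacity_def by (intro sum_mono schubert_rank_swap_ground_le)

lemma capacity_swap_eq:
  assumes "ascent \<alpha> i j" "i \<in> I" "j \<notin> I"
  shows "capacity \<alpha> (insert j (I - {i})) = capacity \<alpha> I"
  unfolding capacity_def
  by (intro sum.cong refl schubert_rank_swap_ground_eq)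
    (use assms in \<open>auto simp: ascent_def level_def\<close>)

section \<open>Weights, levels and capacities under an interchange\<close>

lemma wt_interchange:
  fixes \<gamma> :: "'n::finite composition"
  assumes "i \<noteq> j"
  shows "i \<in> I \<Longrightarrow> j \<notin> I \<Longrightarrow> wt (interchange i j \<gamma>) I = wt \<gamma> (insert j (I - {i}))"
    and "i \<notin> I \<Longrightarrow> j \<in> I \<Longrightarrow> wt (interchange i j \<gamma>) I = wt \<gamma> (insert i (I - {j}))"
    and "(i \<in> I \<longleftrightarrow> j \<in> I) \<Longrightarrow> wt (interchange i j \<gamma>) I = wt \<gamma> I"
proof -
  let ?t = "Transposition.transpose i j"
  have 0: "wt (interchange i j \<gamma>) I = wt \<gamma> (?t ` I)"
    unfolding wt_def by (subst sum.reindex) (auto intro: inj_on_subset[OF inj_transpose])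
  have 1: "?t ` I = {k. ?t k \<in> I}"
  proof (intro set_eqI iffI CollectI)
    fix k assume "k \<in> {k. ?t k \<in> I}"
    then have "?t (?t k) \<in> ?t ` I" by blast
    then show "k \<in> ?t ` I" by simp
  qed auto
  show "i \<in> I \<Longrightarrow> j \<notin> I \<Longrightarrow> wt (interchange i j \<gamma>) I = wt \<gamma> (insert j (I - {i}))"
    unfolding 0 1
    by (intro arg_cong[where f = "wt \<gamma>"]) (use assms in \<open>auto simp: Transposition.transpose_def split: if_splits\<close>)
  show "i \<notin> I \<Longrightarrow> j \<in> I \<Longrightarrow> wt (interchange i j \<gamma>) I = wt \<gamma> (insert i (I - {j}))"
    unfolding 0 1
    by (intro arg_cong[where f = "wt \<gamma>"]) (use assms in \<open>auto simp: Transposition.transpose_def split: if_splits\<close>)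
  show "(i \<in> I \<longleftrightarrow> j \<in> I) \<Longrightarrow> wt (interchange i j \<gamma>) I = wt \<gamma> I"
    unfolding 0 1
    by (intro arg_cong[where f = "wt \<gamma>"]) (use assms in \<open>auto simp: Transposition.transpose_def split: if_splits\<close>)
qed

lemma wt_UNIV_interchange [simp]:
  fixes \<gamma> :: "'n::finite composition"
  shows "wt (interchange i j \<gamma>) UNIV = wt \<gamma> UNIV"
proof (cases "i = j")
  case True
  then have "interchange i j \<gamma> = \<gamma>" by (intro poly_mapping_eqI) simp
  then show ?thesis by simp
qed (simp add: wt_interchange)

lemma level_interchange:
  assumes "i \<noteq> j" "entry \<alpha> i < entry \<alpha> j"
  shows "level (interchange i j \<alpha>) l
    = (if i \<notin> level \<alpha> l \<and> j \<in> level \<alpha> l then insert i (level \<alpha> l - {j}) else level \<alpha> l)"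
  using assms by (auto simp: level_def Transposition.transpose_def split: if_splits)

lemma capacity_interchange_le:
  assumes "i < j" "entry \<alpha> i < entry \<alpha> j"
  shows "capacity (interchange i j \<alpha>) I \<le> capacity \<alpha> I"
  unfolding capacity_def wt_UNIV_interchange
  by (intro sum_mono) (use assms schubert_rank_swap_le[OF assms(1)] in \<open>auto simp: level_interchange\<close>)

text \<open>Passing from \<open>\<alpha>\<close> to \<open>interchange i j \<alpha>\<close> can thus
  tighten only the constraints of sets that contain \<open>j\<close> but not
  \<open>i\<close>.\<close>

lemma capacity_interchange_eq:
  assumes "ascent \<alpha> i j" "i \<in> I \<or> j \<notin> I"
  shows "capacity (interchange i j \<alpha>) I = capacity \<alpha> I"
proof -
  have a: "consecutive i j" "entry \<alpha> i < entry \<alpha> j" "i \<noteq> j"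
    using assms(1) by (auto simp: ascent_def consecutive_def)
  then show ?thesis
    unfolding capacity_def wt_UNIV_interchange
    by (intro sum.cong refl) (use schubert_rank_swap_eq[OF a(1)] assms(2) in \<open>auto simp: level_interchange\<close>)
qed

text \<open>
  The point at position \<open>t\<close> on the line through \<open>\<gamma>\<close> in direction \<open>e\<^sub>i - e\<^sub>j\<close>, meaningful for
  \<open>t \<le> \<gamma>\<^sub>i + \<gamma>\<^sub>j\<close>.
\<close>

definition string_pt :: "'n \<Rightarrow> 'n \<Rightarrow> 'n composition \<Rightarrow> nat \<Rightarrow> 'n composition" where
  "string_pt i j \<gamma> t = Poly_Mapping.update i t (Poly_Mapping.update j (entry \<gamma> i + entry \<gamma> j - t) \<gamma>)"

lemma entry_string_pt:
  "entry (string_pt i j \<gamma> t) k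
    = (if k = i then t else if k = j then entry \<gamma> i + entry \<gamma> j - t else entry \<gamma> k)"
  by (simp add: string_pt_def lookup_update)

lemma string_pt_self: "i \<noteq> j \<Longrightarrow> string_pt i j \<gamma> (entry \<gamma> i) = \<gamma>"
  by (rule poly_mapping_eqI) (auto simp: entry_string_pt)

lemma string_pt_interchange: "i \<noteq> j \<Longrightarrow> string_pt i j \<gamma> (entry \<gamma> j) = interchange i j \<gamma>"
  by (rule poly_mapping_eqI) (auto simp: entry_string_pt Transposition.transpose_def)

lemma string_pt_string_pt:
  "i \<noteq> j \<Longrightarrow> t \<le> entry \<gamma> i + entry \<gamma> j \<Longrightarrow> string_pt i j (string_pt i j \<gamma> t) u = string_pt i j \<gamma> u"
  by (rule poly_mapping_eqI) (auto simp: entry_string_pt)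

lemma interchange_string_pt:
  "i \<noteq> j \<Longrightarrow> t \<le> entry \<gamma> i + entry \<gamma> j
    \<Longrightarrow> interchange i j (string_pt i j \<gamma> t) = string_pt i j \<gamma> (entry \<gamma> i + entry \<gamma> j - t)"
  by (rule poly_mapping_eqI) (auto simp: entry_string_pt Transposition.transpose_def)

text \<open>Stated with all terms added, so that no truncated subtraction occurs; the weight is
  affine in \<open>t\<close>.\<close>

lemma wt_string_pt:
  fixes \<gamma> :: "'n::finite composition"
  assumes "i \<noteq> j" "t \<le> entry \<gamma> i + entry \<gamma> j"
  shows "wt (string_pt i j \<gamma> t) I + (if i \<in> I then entry \<gamma> i else 0) + (if j \<in> I then t else 0)
    = wt \<gamma> I + (if i \<in> I then t else 0) + (if j \<in> I then entry \<gamma> i else 0)"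
proof -
  have d: "I - {i, j} = I - {i} - {j}" by auto
  have s: "wt \<delta> I = (if i \<in> I then entry \<delta> i else 0) + (if j \<in> I then entry \<delta> j else 0) + wt \<delta> (I - {i, j})"
    for \<delta> :: "'n composition"
  proof -
    have "j \<in> I - {i} \<longleftrightarrow> j \<in> I" using assms(1) by auto
    then have "wt \<delta> (I - {i}) = (if j \<in> I then entry \<delta> j else 0) + wt \<delta> (I - {i} - {j})"
      using wt_split[of \<delta> "I - {i}" j] by (simp only:)
    with wt_split[of \<delta> I i] show ?thesis unfolding d by linarith
  qed
  define w where "w = wt \<gamma> (I - {i, j})"
  have w: "wt (string_pt i j \<gamma> t) (I - {i, j}) = w"
    unfolding wt_def w_def by (intro sum.cong refl) (auto simp: entry_string_pt)
  have "entry (string_pt i j \<gamma> t) i = t" "entry (string_pt i j \<gamma> t) j + t = entry \<gamma> i + entry \<gamma> j"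
    using assms by (auto simp: entry_string_pt)
  then show ?thesis
    using s[of \<gamma>, folded w_def] s[of "string_pt i j \<gamma> t", unfolded w] by (cases "i \<in> I"; cases "j \<in> I") simp_all
qed


section \<open>Lattice points satisfying the capacity constraints\<close>

definition schubitope :: "'n::{finite,linorder} composition \<Rightarrow> 'n composition set" where
  "schubitope \<alpha> = {\<gamma>. wt \<gamma> UNIV = wt \<alpha> UNIV \<and> (\<forall>I. wt \<gamma> I \<le> capacity \<alpha> I)}"

lemma schubitope_self: "\<alpha> \<in> schubitope \<alpha>"
  by (simp add: schubitope_def wt_le_capacity)

text \<open>For an upper set the constraints on \<open>K\<close> and \<open>- K\<close> add up to
  the fixed total weight, so both are equalities. An entry is the difference of the weights of two
  upper sets.\<close>

lemma schubitope_weakly_decreasing: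
  fixes \<alpha> :: "'n::{finite,linorder} composition"
  assumes "weakly_decreasing \<alpha>"
  shows "schubitope \<alpha> = {\<alpha>}"
proof -
  have "\<gamma> = \<alpha>" if \<gamma>: "\<gamma> \<in> schubitope \<alpha>" for \<gamma>
  proof (rule poly_mapping_eqI)
    fix k :: 'n
    have *: "wt \<gamma> K = wt \<alpha> K" if "upset K" for K
    proof -
      have "wt \<gamma> K \<le> wt \<alpha> K" "wt \<gamma> (- K) \<le> wt \<alpha> (- K)"
        using \<gamma> capacity_upset_le[OF that, of \<alpha>] capacity_Compl_upset_le[OF assms that]
        unfolding schubitope_def by (auto intro: le_trans)
      moreover have "wt \<gamma> UNIV = wt \<alpha> UNIV" using \<gamma> by (simp add: schubitope_def)
      ultimately show ?thesis
        using wt_Compl[of \<gamma> K] wt_Compl[of \<alpha> K] by linarith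
    qed
    have "upset {k..}" "upset {k<..}" by (auto simp: upset_def)
    moreover have "{k..} - {k} = {k<..}" by auto
    ultimately show "entry \<gamma> k = entry \<alpha> k"
      using *[of "{k..}"] *[of "{k<..}"] wt_remove[of k "{k..}" \<gamma>] wt_remove[of k "{k..}" \<alpha>] by simp
  qed
  with schubitope_self show ?thesis by blast
qed

text \<open>Convexity: each weight is affine along the string, so between \<open>\<gamma>\<close>
  and its mirror image it never exceeds the larger end value.\<close>

lemma string_pt_mem_schubitope:
  assumes "i \<noteq> j" "\<gamma> \<in> schubitope \<alpha>" "interchange i j \<gamma> \<in> schubitope \<alpha>"
    "min (entry \<gamma> i) (entry \<gamma> j) \<le> t" "t \<le> max (entry \<gamma> i) (entry \<gamma> j)"
  shows "string_pt i j \<gamma> t \<in> schubitope \<alpha>"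
proof -
  have t: "t \<le> entry \<gamma> i + entry \<gamma> j" using assms(5) by auto
  note w = wt_string_pt[OF assms(1) t]
    wt_string_pt[OF assms(1), of "entry \<gamma> j" \<gamma>, unfolded string_pt_interchange[OF assms(1)]]
  have "wt (string_pt i j \<gamma> t) I \<le> capacity \<alpha> I" for I
  proof -
    have "wt \<gamma> I \<le> capacity \<alpha> I" "wt (interchange i j \<gamma>) I \<le> capacity \<alpha> I"
      using assms(2,3) by (auto simp: schubitope_def)
    moreover have "wt (string_pt i j \<gamma> t) I \<le> max (wt \<gamma> I) (wt (interchange i j \<gamma>) I)"
      using w[of I] assms(4,5) by (auto split: if_splits simp: min_def max_def)
    ultimately show ?thesis by simp
  qed
  moreover have "wt (string_pt i j \<gamma> t) UNIV = wt \<alpha> UNIV"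
    using w(1)[of UNIV] assms(2) by (simp add: schubitope_def)
  ultimately show ?thesis by (simp add: schubitope_def)
qed

text \<open>On sets with \<open>j\<close> but not \<open>i\<close> the weight does not grow. On sets
  with \<open>i\<close> but not \<open>j\<close> the new weight is the old weight of the set with
  \<open>i\<close> replaced by \<open>j\<close>, whose capacity is no larger.\<close>

lemma interchange_mem_schubitope:
  assumes "i < j" "entry \<gamma> i \<le> entry \<gamma> j" "\<gamma> \<in> schubitope \<alpha>"
  shows "interchange i j \<gamma> \<in> schubitope \<alpha>"
proof -
  have ne: "i \<noteq> j" using assms(1) by simp
  have "wt (interchange i j \<gamma>) I \<le> capacity \<alpha> I" for I
  proof -
    consider "i \<in> I" "j \<notin> I" | "i \<notin> I" "j \<in> I" | "i \<in> I \<longleftrightarrow> j \<in> I" by blast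
    then show ?thesis
    proof cases
      case 1
      then have "wt (interchange i j \<gamma>) I \<le> capacity \<alpha> (insert j (I - {i}))"
        using assms(3) by (simp add: wt_interchange(1)[OF ne] schubitope_def)
      with capacity_swap_le[OF assms(1) 1, of \<alpha>] show ?thesis by simp
    next
      case 2
      then have "wt (interchange i j \<gamma>) I \<le> wt \<gamma> I"
        using wt_string_pt[OF ne, of "entry \<gamma> j" \<gamma> I] assms(2) by (simp add: string_pt_interchange[OF ne])
      also have "\<dots> \<le> capacity \<alpha> I" using assms(3) by (simp add: schubitope_def)
      finally show ?thesis .
    next
      case 3
      with assms(3) show ?thesis by (simp add: wt_interchange(3)[OF ne] schubitope_def)
    qed
  qed
  with assms(3) show ?thesis by (simp add: schubitope_def)
qed

text \<open>At an ascent of \<open>\<alpha>\<close> the capacity is symmetric in \<open>i\<close>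
  and \<open>j\<close>, so no comparison of entries of \<open>\<gamma>\<close> is required.\<close>

lemma interchange_ascent_mem_schubitope:
  assumes "ascent \<alpha> i j" "\<gamma> \<in> schubitope \<alpha>"
  shows "interchange i j \<gamma> \<in> schubitope \<alpha>"
proof -
  have ne: "i \<noteq> j" using assms(1) by (auto simp: ascent_def consecutive_def)
  have "wt (interchange i j \<gamma>) I \<le> capacity \<alpha> I" for I
  proof -
    consider "i \<in> I" "j \<notin> I" | "i \<notin> I" "j \<in> I" | "i \<in> I \<longleftrightarrow> j \<in> I" by blast
    then show ?thesis
    proof cases
      case 1
      then have "wt (interchange i j \<gamma>) I \<le> capacity \<alpha> (insert j (I - {i}))"
        using assms(2) by (simp add: wt_interchange(1)[OF ne] schubitope_def)
      with capacity_swap_eq[OF assms(1) 1] show ?thesis by simp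
    next
      case 2
      then have "wt (interchange i j \<gamma>) I \<le> capacity \<alpha> (insert i (I - {j}))"
        using assms(2) by (simp add: wt_interchange(2)[OF ne] schubitope_def)
      moreover have "insert j (insert i (I - {j}) - {i}) = I" using 2 by auto
      ultimately show ?thesis
        using capacity_swap_eq[OF assms(1), of "insert i (I - {j})"] ne by simp
    next
      case 3
      with assms(2) show ?thesis by (simp add: wt_interchange(3)[OF ne] schubitope_def)
    qed
  qed
  with assms(2) show ?thesis by (simp add: schubitope_def)
qed

lemma schubitope_interchange_subset:
  assumes "ascent \<alpha> i j"
  shows "schubitope (interchange i j \<alpha>) \<subseteq> schubitope \<alpha>"
  using assms capacity_interchange_le[of i j \<alpha>]
  by (auto simp: schubitope_def ascent_def consecutive_def intro: le_trans)

text \<open>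
  The least \<open>t\<close> satisfying the constraints that contain \<open>j\<close> but not \<open>i\<close> also satisfies those that
  contain \<open>i\<close> but not \<open>j\<close>, because the capacity is submodular; integrality of the capacity makes
  it an integer.
\<close>

lemma schubitope_string_source_aux:
  assumes asc: "ascent \<alpha> i j" and \<gamma>: "\<gamma> \<in> schubitope \<alpha>" and ge: "entry \<gamma> j \<le> entry \<gamma> i"
  obtains t where "t \<le> entry \<gamma> j" "string_pt i j \<gamma> (entry \<gamma> i + t) \<in> schubitope (interchange i j \<alpha>)"
proof -
  let ?\<alpha> = "interchange i j \<alpha>"
  let ?S = "{I. i \<notin> I \<and> j \<in> I}"
  have ne: "i \<noteq> j" using asc by (auto simp: ascent_def consecutive_def)
  have cap: "wt \<gamma> I \<le> capacity ?\<alpha> I" if "i \<in> I \<or> j \<notin> I" for I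
    using \<gamma> capacity_interchange_eq[OF asc that] by (simp add: schubitope_def)
  \<comment> \<open>Truncation makes \<open>t\<close> zero if no constraint with \<open>j\<close>
    but not \<open>i\<close> fails for \<open>?\<alpha>\<close>; the remaining constraints hold at
    \<open>\<gamma>\<close> by \<open>cap\<close>.\<close>
  define t where "t = Max ((\<lambda>I. wt \<gamma> I - capacity ?\<alpha> I) ` ?S)"
  have "{j} \<in> ?S" using ne by simp
  then have "t \<in> (\<lambda>I. wt \<gamma> I - capacity ?\<alpha> I) ` ?S"
    unfolding t_def by (intro Max_in) auto
  then obtain I where I: "i \<notin> I" "j \<in> I" "t = wt \<gamma> I - capacity ?\<alpha> I" by auto
  have ub: "wt \<gamma> J \<le> capacity ?\<alpha> J + t" if "i \<notin> J" "j \<in> J" for J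
  proof -
    have "wt \<gamma> J - capacity ?\<alpha> J \<le> t"
      unfolding t_def by (intro Max_ge) (use that in auto)
    then show ?thesis by simp
  qed
  have lb: "wt \<gamma> J + t \<le> capacity ?\<alpha> J" if J: "i \<in> J" "j \<notin> J" for J
  proof (cases "t = 0")
    case True
    with cap[of J] J show ?thesis by simp
  next
    case False
    \<comment> \<open>Since \<open>t\<close> is positive, the subtraction in \<open>I(3)\<close> is
      exact. The union contains \<open>i\<close> and the intersection omits \<open>j\<close>, so
      \<open>cap\<close> covers both, and submodularity transfers the excess of \<open>I\<close> to
      slack of \<open>J\<close>.\<close>
    have "wt \<gamma> (I \<union> J) \<le> capacity ?\<alpha> (I \<union> J)" "wt \<gamma> (I \<inter> J) \<le> capacity ?\<alpha> (I \<inter> J)"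
      using I J by (auto intro!: cap)
    with wt_Un_Int[of \<gamma> I J] capacity_submodular[of ?\<alpha> I J] I(3) False show ?thesis by linarith
  qed
  \<comment> \<open>Removing \<open>j\<close> from \<open>I\<close> restores the constraint, so the
    excess is at most the entry at \<open>j\<close>.\<close>
  have tj: "t \<le> entry \<gamma> j"
  proof -
    have "wt \<gamma> (I - {j}) \<le> capacity ?\<alpha> (I - {j})" by (intro cap) auto
    also have "\<dots> \<le> capacity ?\<alpha> I" by (intro capacity_mono) auto
    finally show ?thesis using I wt_remove[of j I \<gamma>] by linarith
  qed
  have w: "wt (string_pt i j \<gamma> (entry \<gamma> i + t)) J + (if i \<in> J then entry \<gamma> i else 0)
      + (if j \<in> J then entry \<gamma> i + t else 0)
    = wt \<gamma> J + (if i \<in> J then entry \<gamma> i + t else 0) + (if j \<in> J then entry \<gamma> i else 0)" for J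
    using tj by (intro wt_string_pt[OF ne]) auto
  have "wt (string_pt i j \<gamma> (entry \<gamma> i + t)) J \<le> capacity ?\<alpha> J" for J
    using w[of J] lb[of J] ub[of J] cap[of J] by (auto split: if_splits)
  moreover have "wt (string_pt i j \<gamma> (entry \<gamma> i + t)) UNIV = wt \<alpha> UNIV"
    using w[of UNIV] \<gamma> by (simp add: schubitope_def)
  ultimately have "string_pt i j \<gamma> (entry \<gamma> i + t) \<in> schubitope ?\<alpha>"
    by (simp add: schubitope_def)
  with tj that show ?thesis by blast
qed

text \<open>The inductive step of all later arguments. If
  \<open>entry \<gamma> i < entry \<gamma> j\<close>, the auxiliary lemma is applied to the mirror
  image of \<open>\<gamma>\<close>, which lies in \<open>schubitope \<alpha>\<close> and on the same
  string.\<close>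

lemma schubitope_string_source:
  assumes asc: "ascent \<alpha> i j" and \<gamma>: "\<gamma> \<in> schubitope \<alpha>"
  obtains \<delta> t where "\<delta> \<in> schubitope (interchange i j \<alpha>)" "entry \<delta> j \<le> t" "t \<le> entry \<delta> i"
    "\<gamma> = string_pt i j \<delta> t"
proof -
  have ne: "i \<noteq> j" using asc by (auto simp: ascent_def consecutive_def)
  show ?thesis
  proof (cases "entry \<gamma> j \<le> entry \<gamma> i")
    case True
    from schubitope_string_source_aux[OF asc \<gamma> True] obtain t where t: "t \<le> entry \<gamma> j"
      "string_pt i j \<gamma> (entry \<gamma> i + t) \<in> schubitope (interchange i j \<alpha>)" .
    show ?thesis
      by (rule that[OF t(2), of "entry \<gamma> i"])
        (use t(1) True ne in \<open>auto simp: entry_string_pt string_pt_string_pt string_pt_self\<close>)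
  next
    case False
    let ?\<gamma> = "interchange i j \<gamma>"
    have "entry ?\<gamma> j \<le> entry ?\<gamma> i" using False by simp
    from schubitope_string_source_aux[OF asc interchange_ascent_mem_schubitope[OF asc \<gamma>] this]
    obtain t where t: "t \<le> entry ?\<gamma> j"
      "string_pt i j ?\<gamma> (entry ?\<gamma> i + t) \<in> schubitope (interchange i j \<alpha>)" .
    have "string_pt i j ?\<gamma> (entry \<gamma> i) = \<gamma>"
      using string_pt_interchange[OF ne, of ?\<gamma>] by simp
    with t False ne show ?thesis
      by (intro that[OF t(2), of "entry \<gamma> i"]) (auto simp: entry_string_pt string_pt_string_pt)
  qed
qed


section \<open>The order on compositions\<close>

text \<open>Follows the recursion of \<open>key_poly\<close>, but with an arbitrary ascent;
  \<open>strict_rises\<close> shrinks at each interchange.\<close>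

lemma composition_ascent_induct [case_names weakly_decreasing ascent]:
  fixes \<alpha> :: "'n::{finite,linorder} composition"
  assumes "\<And>\<alpha>. weakly_decreasing \<alpha> \<Longrightarrow> P \<alpha>"
    and "\<And>\<alpha> i j. ascent \<alpha> i j \<Longrightarrow> P (interchange i j \<alpha>) \<Longrightarrow> P \<alpha>"
  shows "P \<alpha>"
proof (induction "card (strict_rises \<alpha>)" arbitrary: \<alpha> rule: less_induct)
  case less
  show ?case
  proof (cases "weakly_decreasing \<alpha>")
    case False
    then obtain i j where "ascent \<alpha> i j" using ascent_exists by blast
    with less strict_rises_interchange assms(2) show ?thesis by blast
  qed (rule assms(1))
qed

lemma kappa_le_refl: "\<alpha> \<le>\<^sub>\<kappa> \<alpha>"
  by (simp add: kappa_le_def)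

lemma kappa_le_trans: "\<gamma> \<le>\<^sub>\<kappa> \<beta> \<Longrightarrow> \<beta> \<le>\<^sub>\<kappa> \<alpha> \<Longrightarrow> \<gamma> \<le>\<^sub>\<kappa> \<alpha>"
  unfolding kappa_le_def by (metis rtranclp_trans)

lemma kappa_le_move: "\<beta> \<le>\<^sub>\<kappa> \<alpha> \<Longrightarrow> kappa_move \<beta> \<gamma> \<Longrightarrow> \<gamma> \<le>\<^sub>\<kappa> \<alpha>"
  unfolding kappa_le_def by (rule rtranclp.rtrancl_into_rtrancl)

text \<open>A transfer is one step along the string, as an exchange is its reflection. Positivity of
  \<open>entry \<gamma> j\<close> keeps the subtraction exact.\<close>

lemma transfer_eq_string_pt:
  "i \<noteq> j \<Longrightarrow> 0 < entry \<gamma> j \<Longrightarrow> \<gamma> + unit_vec i - unit_vec j = string_pt i j \<gamma> (Suc (entry \<gamma> i))"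
  by (rule poly_mapping_eqI) (auto simp: entry_string_pt lookup_add lookup_minus lookup_single when_def)

lemma kappa_move_string_pt:
  assumes "i < j" "entry \<gamma> i + 1 < entry \<gamma> j"
  shows "kappa_move \<gamma> (string_pt i j \<gamma> (Suc (entry \<gamma> i)))"
  using kappa_move.transfer[OF assms(1), of \<gamma>] assms by (simp add: transfer_eq_string_pt del: One_nat_def)

text \<open>From the mirror image of \<open>\<gamma>\<close>, whose smaller entry is at
  \<open>i\<close>, transfers reach every point up to the middle of the string. Each point beyond
  the middle is one exchange away from its mirror image.\<close>

lemma kappa_le_string_pt:
  assumes "i < j" "interchange i j \<gamma> \<le>\<^sub>\<kappa> \<alpha>" "entry \<gamma> j \<le> t" "t \<le> entry \<gamma> i"
  shows "string_pt i j \<gamma> t \<le>\<^sub>\<kappa> \<alpha>"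
proof -
  let ?m = "entry \<gamma> i + entry \<gamma> j"
  have ne: "i \<noteq> j" using assms(1) by simp
  have half: "2 * u \<le> ?m \<Longrightarrow> string_pt i j \<gamma> u \<le>\<^sub>\<kappa> \<alpha>" if "entry \<gamma> j \<le> u" for u
    using that
  proof (induction u rule: dec_induct)
    case base
    then show ?case using assms(2) string_pt_interchange[OF ne] by simp
  next
    case (step u)
    let ?\<delta> = "string_pt i j \<gamma> u"
    have "kappa_move ?\<delta> (string_pt i j ?\<delta> (Suc (entry ?\<delta> i)))"
      using step.prems ne by (intro kappa_move_string_pt assms(1)) (auto simp: entry_string_pt)
    moreover have "string_pt i j ?\<delta> (Suc (entry ?\<delta> i)) = string_pt i j \<gamma> (Suc u)"
      using step.prems ne by (simp add: entry_string_pt string_pt_string_pt)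
    ultimately show ?case using step by (auto intro: kappa_le_move)
  qed
  show ?thesis
  proof (cases "2 * t \<le> ?m")
    case True
    with half assms(3) show ?thesis by blast
  next
    case False
    let ?\<delta> = "string_pt i j \<gamma> (?m - t)"
    have "?\<delta> \<le>\<^sub>\<kappa> \<alpha>" using False assms(4) by (intro half) auto
    moreover have "kappa_move ?\<delta> (interchange i j ?\<delta>)"
      using False assms(4) ne by (intro kappa_move.exchange assms(1)) (auto simp: entry_string_pt)
    moreover have "interchange i j ?\<delta> = string_pt i j \<gamma> t"
      using assms(4) ne by (simp add: interchange_string_pt)
    ultimately show ?thesis by (metis kappa_le_move)
  qed
qed

section \<open>Stability of the order under an adjacent interchange\<close>

lemma transpose_less:
  assumes "consecutive i j" "a < b" "\<not> (a = i \<and> b = j)"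
  shows "Transposition.transpose i j a < Transposition.transpose i j b"
proof -
  have "i < j" "\<And>k. \<not> (i < k \<and> k < j)" using assms(1) by (auto simp: consecutive_def)
  from this(1) this(2)[of a] this(2)[of b] assms(2,3) show ?thesis
    by (auto simp: Transposition.transpose_def not_less)
qed

lemma transpose_conj:
  "Transposition.transpose i j (Transposition.transpose (Transposition.transpose i j a) (Transposition.transpose i j b) k)
    = Transposition.transpose a b (Transposition.transpose i j k)"
proof -
  have "k = Transposition.transpose i j c \<longleftrightarrow> Transposition.transpose i j k = c" for c
    by (metis transpose_involutory)
  then show ?thesis by (simp add: Transposition.transpose_def[of a b] Transposition.transpose_def[of "Transposition.transpose i j a"])
qed

text \<open>An adjacent transposition keeps the order of every pair except \<open>(i, j)\<close>, so
  it conjugates moves into moves. For that pair, an exchange is undone, and a transfer leaves the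
  entry at \<open>i\<close> at most the entry at \<open>j\<close>.\<close>

lemma kappa_move_interchange_conj:
  assumes ij: "consecutive i j" and mv: "kappa_move \<gamma> \<delta>"
  shows "kappa_move (interchange i j \<gamma>) (interchange i j \<delta>)
    \<or> interchange i j \<delta> = \<gamma> \<or> entry \<delta> i \<le> entry \<delta> j"
  using mv
proof cases
  case (exchange a b)
  show ?thesis
  proof (cases "a = i \<and> b = j")
    case True
    with exchange show ?thesis by simp
  next
    case False
    let ?t = "Transposition.transpose i j"
    have lt: "?t a < ?t b" using transpose_less[OF ij exchange(2) False] .
    have "interchange i j \<delta> = interchange (?t a) (?t b) (interchange i j \<gamma>)"
      unfolding exchange(1)
      by (rule poly_mapping_eqI) (simp add: transpose_conj)
    then show ?thesis
      using kappa_move.exchange[OF lt, of "interchange i j \<gamma>"] exchange(3) by simp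
  qed
next
  case (transfer a b)
  show ?thesis
  proof (cases "a = i \<and> b = j")
    case True
    with transfer have "entry \<delta> i \<le> entry \<delta> j"
      by (auto simp: lookup_add lookup_minus lookup_single when_def)
    then show ?thesis by simp
  next
    case False
    let ?t = "Transposition.transpose i j"
    have lt: "?t a < ?t b" using transpose_less[OF ij transfer(2) False] .
    have "interchange i j \<delta> = interchange i j \<gamma> + unit_vec (?t a) - unit_vec (?t b)"
      unfolding transfer(1)
      by (rule poly_mapping_eqI) (simp add: lookup_add lookup_minus flip: interchange_single)
    then show ?thesis
      using kappa_move.transfer[OF lt, of "interchange i j \<gamma>"] transfer(3) by simp
  qed
qed

text \<open>Order counterpart of \<open>interchange_ascent_mem_schubitope\<close>, by induction
  along the moves. When the entry at \<open>i\<close> is at most the entry at \<open>j\<close>, the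
  interchange is itself a move or the identity.\<close>

lemma kappa_le_interchange_ascent:
  assumes "ascent \<alpha> i j" "\<gamma> \<le>\<^sub>\<kappa> \<alpha>"
  shows "interchange i j \<gamma> \<le>\<^sub>\<kappa> \<alpha>"
proof -
  have ij: "consecutive i j" "i < j" "entry \<alpha> i < entry \<alpha> j"
    using assms(1) by (auto simp: ascent_def consecutive_def)
  have *: "interchange i j \<delta> \<le>\<^sub>\<kappa> \<alpha>" if "\<delta> \<le>\<^sub>\<kappa> \<alpha>" "entry \<delta> i \<le> entry \<delta> j" for \<delta>
  proof (cases "entry \<delta> i = entry \<delta> j")
    case True
    then have "interchange i j \<delta> = \<delta>"
      by (intro poly_mapping_eqI) (auto simp: Transposition.transpose_def)
    with that show ?thesis by simp
  next
    case False
    with that ij(2) show ?thesis by (intro kappa_le_move[OF that(1)] kappa_move.exchange) auto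
  qed
  have "kappa_move\<^sup>*\<^sup>* \<alpha> \<gamma>" using assms(2) by (simp add: kappa_le_def)
  then show ?thesis
  proof induction
    case base
    show ?case using ij(3) by (intro * kappa_le_refl) auto
  next
    case (step \<gamma> \<delta>)
    have "\<gamma> \<le>\<^sub>\<kappa> \<alpha>" "\<delta> \<le>\<^sub>\<kappa> \<alpha>" using step.hyps by (auto simp: kappa_le_def)
    with kappa_move_interchange_conj[OF ij(1) step.hyps(2)] show ?case
      using * step.IH by (metis kappa_le_move)
  qed
qed

lemma schubitope_imp_kappa_le: "\<gamma> \<in> schubitope \<alpha> \<Longrightarrow> \<gamma> \<le>\<^sub>\<kappa> \<alpha>"
proof (induction \<alpha> arbitrary: \<gamma> rule: composition_ascent_induct)
  case (weakly_decreasing \<alpha>)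
  then show ?case by (simp add: schubitope_weakly_decreasing kappa_le_refl)
next
  case (ascent \<alpha> i j)
  have ij: "i < j" "entry \<alpha> i < entry \<alpha> j"
    using ascent.hyps by (auto simp: ascent_def consecutive_def)
  from schubitope_string_source[OF ascent.hyps ascent.prems] obtain \<delta> t where
    \<delta>: "\<delta> \<in> schubitope (interchange i j \<alpha>)" "entry \<delta> j \<le> t" "t \<le> entry \<delta> i"
    and \<gamma>: "\<gamma> = string_pt i j \<delta> t" .
  have "interchange i j \<alpha> \<le>\<^sub>\<kappa> \<alpha>"
    using ij by (intro kappa_le_move[OF kappa_le_refl] kappa_move.exchange)
  with ascent.IH[OF \<delta>(1)] have "\<delta> \<le>\<^sub>\<kappa> \<alpha>" by (rule kappa_le_trans)
  with kappa_le_interchange_ascent[OF ascent.hyps] have "interchange i j \<delta> \<le>\<^sub>\<kappa> \<alpha>" .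
  with kappa_le_string_pt[OF ij(1)] \<delta> \<gamma> show ?case by simp
qed

text \<open>Each move stays inside: an exchange by monotonicity of the capacity, a transfer because
  it lands between a point and its mirror image.\<close>

lemma kappa_le_imp_schubitope:
  assumes "\<gamma> \<le>\<^sub>\<kappa> \<alpha>"
  shows "\<gamma> \<in> schubitope \<alpha>"
proof -
  have "kappa_move\<^sup>*\<^sup>* \<alpha> \<gamma>" using assms by (simp add: kappa_le_def)
  then show ?thesis
  proof induction
    case base
    show ?case by (rule schubitope_self)
  next
    case (step \<gamma> \<delta>)
    from step.hyps(2) show ?case
    proof cases
      case (exchange i j)
      with step.IH show ?thesis by (simp add: interchange_mem_schubitope)
    next
      case (transfer i j)
      then have "\<delta> = string_pt i j \<gamma> (Suc (entry \<gamma> i))" by (simp add: transfer_eq_string_pt del: One_nat_def)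
      moreover have "interchange i j \<gamma> \<in> schubitope \<alpha>"
        using transfer by (intro interchange_mem_schubitope step.IH) auto
      ultimately show ?thesis
        using transfer step.IH by (simp add: string_pt_mem_schubitope)
    qed
  qed
qed

lemma mem_schubitope_iff: "\<gamma> \<in> schubitope \<alpha> \<longleftrightarrow> \<gamma> \<le>\<^sub>\<kappa> \<alpha>"
  using kappa_le_imp_schubitope schubitope_imp_kappa_le by blast


section \<open>Squared lengths\<close>

definition sqnorm :: "'n::finite composition \<Rightarrow> int" where
  "sqnorm \<gamma> = (\<Sum>k\<in>UNIV. (int (entry \<gamma> k))\<^sup>2)"

lemma sqnorm_interchange [simp]: "sqnorm (interchange i j \<gamma>) = sqnorm \<gamma>"
  unfolding sqnorm_def lookup_interchange
  by (rule sum.reindex_bij_betw[of "Transposition.transpose i j" UNIV UNIV "\<lambda>k. (int (entry \<gamma> k))\<^sup>2"]) simp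

lemma sqnorm_string_pt:
  assumes "i \<noteq> j" "t \<le> entry \<gamma> i + entry \<gamma> j"
  shows "sqnorm (string_pt i j \<gamma> t)
    = sqnorm \<gamma> - 2 * (int (entry \<gamma> i) - int t) * (int t - int (entry \<gamma> j))"
proof -
  have s: "sqnorm \<delta> = (int (entry \<delta> i))\<^sup>2 + (int (entry \<delta> j))\<^sup>2 + (\<Sum>k\<in>UNIV - {i} - {j}. (int (entry \<delta> k))\<^sup>2)"
    for \<delta> :: "'a composition"
    unfolding sqnorm_def using assms(1) by (simp add: sum.remove[of _ i] sum.remove[of _ j])
  have r: "(\<Sum>k\<in>UNIV - {i} - {j}. (int (entry (string_pt i j \<gamma> t) k))\<^sup>2) = (\<Sum>k\<in>UNIV - {i} - {j}. (int (entry \<gamma> k))\<^sup>2)"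
    by (intro sum.cong refl) (auto simp: entry_string_pt)
  have e: "int (entry (string_pt i j \<gamma> t) i) = int t"
    "int (entry (string_pt i j \<gamma> t) j) = int (entry \<gamma> i) + int (entry \<gamma> j) - int t"
    using assms by (auto simp: entry_string_pt of_nat_diff)
  show ?thesis
    unfolding s[of \<gamma>] s[of "string_pt i j \<gamma> t"] r e by algebra
qed

text \<open>Strict convexity of the squared length: the product in \<open>sqnorm_string_pt\<close>
  is nonnegative between the ends and vanishes only there.\<close>

lemma sqnorm_string_pt_le:
  assumes "i \<noteq> j" "entry \<gamma> j \<le> t" "t \<le> entry \<gamma> i"
  shows "sqnorm (string_pt i j \<gamma> t) \<le> sqnorm \<gamma>"
    and "sqnorm (string_pt i j \<gamma> t) = sqnorm \<gamma> \<Longrightarrow> t = entry \<gamma> i \<or> t = entry \<gamma> j"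
  using assms by (auto simp: sqnorm_string_pt)

lemma sqnorm_schubitope_le: "\<gamma> \<in> schubitope \<alpha> \<Longrightarrow> sqnorm \<gamma> \<le> sqnorm \<alpha>"
proof (induction \<alpha> arbitrary: \<gamma> rule: composition_ascent_induct)
  case (weakly_decreasing \<alpha>)
  then show ?case by (simp add: schubitope_weakly_decreasing)
next
  case (ascent \<alpha> i j)
  have ne: "i \<noteq> j" using ascent.hyps by (auto simp: ascent_def consecutive_def)
  from schubitope_string_source[OF ascent.hyps ascent.prems] obtain \<delta> t where
    \<delta>: "\<delta> \<in> schubitope (interchange i j \<alpha>)" "entry \<delta> j \<le> t" "t \<le> entry \<delta> i"
    and \<gamma>: "\<gamma> = string_pt i j \<delta> t" .
  with sqnorm_string_pt_le(1)[OF ne \<delta>(2,3)] ascent.IH[OF \<delta>(1)] show ?case by simp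
qed


section \<open>Coefficients of key polynomials\<close>

lemma lookup_mult_var:
  fixes f :: "('n, int) mpolynomial"
  shows "Poly_Mapping.lookup (f * var k) (\<delta> + unit_vec k) = Poly_Mapping.lookup f \<delta>"
  by (induction f rule: poly_mapping_sum_induct)
    (simp_all add: distrib_right lookup_add mult_single lookup_single when_def)

lemma lookup_mult_var_eq_0:
  fixes f :: "('n, int) mpolynomial"
  assumes "entry \<delta> k = 0"
  shows "Poly_Mapping.lookup (f * var k) \<delta> = 0"
proof (induction f rule: poly_mapping_sum_induct)
  case (add f a b)
  have "a + unit_vec k \<noteq> \<delta>"
    using assms by (metis add_is_0 lookup_add lookup_single_eq zero_neq_one)
  with add show ?case
    by (simp add: distrib_right lookup_add mult_single lookup_single)
qed simp

text \<open>Comparing coefficients in \<open>demazure_mult\<close> along the string gives a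
  first-order recurrence in \<open>t\<close>.\<close>

lemma lookup_demazure_string_aux:
  fixes f :: "('n::linorder, int) mpolynomial"
  assumes "i \<noteq> j" and m: "m = entry \<gamma> i + entry \<gamma> j" and "t \<le> m"
  defines "F \<equiv> \<lambda>u. Poly_Mapping.lookup f (string_pt i j \<gamma> u)"
  shows "Poly_Mapping.lookup (demazure i j f) (string_pt i j \<gamma> t)
    = (\<Sum>u=m-t..m. F u) - (\<Sum>u<t. F u)"
  using \<open>t \<le> m\<close>
proof (induction t)
  let ?q = "string_pt i j \<gamma>" and ?h = "demazure i j f"
  have eq: "Poly_Mapping.lookup (?h * var i) \<delta> - Poly_Mapping.lookup (?h * var j) \<delta>
    = Poly_Mapping.lookup (f * var i) \<delta> - Poly_Mapping.lookup (exchange_vars i j f * var j) \<delta>" for \<delta>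
    using arg_cong[OF demazure_mult[OF assms(1), of f], of "\<lambda>p. Poly_Mapping.lookup p \<delta>"]
    by (simp add: right_diff_distrib lookup_minus mult.commute)
  have ex: "Poly_Mapping.lookup (exchange_vars i j f) (?q u) = F (m - u)" if "u \<le> m" for u
    using that assms(1) by (simp add: lookup_exchange_vars interchange_string_pt F_def m)
  {
    case 0
    \<comment> \<open>At this exponent the products with \<open>var i\<close> have coefficient 0,
      which yields the initial value \<open>F m\<close>.\<close>
    have "entry (?q 0 + unit_vec j) i = 0"
      using assms(1) by (simp add: lookup_add entry_string_pt lookup_single)
    with eq[of "?q 0 + unit_vec j"] show ?case
      by (simp add: lookup_mult_var lookup_mult_var_eq_0 ex del: One_nat_def)
  next
    case (Suc t)
    \<comment> \<open>One exponent seen from two neighbouring string points; it links the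
      coefficients at \<open>t\<close> and \<open>Suc t\<close>.\<close>
    have "?q t + unit_vec i = ?q (Suc t) + unit_vec j"
      using assms(1) Suc.prems
      by (intro poly_mapping_eqI) (auto simp: lookup_add entry_string_pt lookup_single when_def m)
    with eq[of "?q t + unit_vec i"] have
      "Poly_Mapping.lookup ?h (?q (Suc t)) = Poly_Mapping.lookup ?h (?q t) - F t + F (m - Suc t)"
      using Suc.prems lookup_mult_var[of f i "?q t"] lookup_mult_var[of ?h i "?q t"]
      by (simp add: lookup_mult_var ex F_def del: One_nat_def)
    moreover have "{m - Suc t..m} = insert (m - Suc t) {m - t..m}" using Suc.prems by auto
    moreover have "m - Suc t \<notin> {m - t..m}" using Suc.prems by auto
    ultimately show ?case using Suc by simp
  }
qed

text \<open>Cancelling the common terms makes the formula symmetric under reflection. Only positions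
  \<open>u\<close> with \<open>t\<close> between \<open>u\<close> and \<open>m - u\<close>
  remain.\<close>

lemma lookup_demazure_string:
  fixes f :: "('n::linorder, int) mpolynomial"
  assumes "i \<noteq> j" and m: "m = entry \<gamma> i + entry \<gamma> j" and t: "t \<le> m"
  defines "F \<equiv> \<lambda>u. Poly_Mapping.lookup f (string_pt i j \<gamma> u)"
  shows "Poly_Mapping.lookup (demazure i j f) (string_pt i j \<gamma> t)
    = (\<Sum>u=max t (m - t)..m. F u) - (\<Sum>u<min t (m - t). F u)"
proof (cases "t \<le> m - t")
  case True
  then show ?thesis
    using lookup_demazure_string_aux[OF assms(1) m t, of f] by (simp add: F_def max_def min_def)
next
  case False
  have "{m - t..m} = {m - t..<t} \<union> {t..m}" "{..<t} = {..<m - t} \<union> {m - t..<t}"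
    using False t by auto
  then have "(\<Sum>u=m-t..m. F u) = (\<Sum>u\<in>{m - t..<t}. F u) + (\<Sum>u=t..m. F u)"
    "(\<Sum>u<t. F u) = (\<Sum>u<m-t. F u) + (\<Sum>u\<in>{m - t..<t}. F u)"
    by (auto simp: sum.union_disjoint disjoint_iff)
  with False show ?thesis
    using lookup_demazure_string_aux[OF assms(1) m t, of f] by (simp add: F_def max_def min_def)
qed

text \<open>A nonzero coefficient at \<open>\<gamma>\<close> needs a monomial on its string such
  that \<open>\<gamma>\<close> lies between that monomial and its mirror image. Both ends are in
  \<open>schubitope \<alpha>\<close>, hence so is \<open>\<gamma>\<close>.\<close>

lemma keys_key_poly_subset: "Poly_Mapping.keys (key_poly \<alpha>) \<subseteq> schubitope \<alpha>"
proof (induction \<alpha> rule: composition_ascent_induct)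
  case (weakly_decreasing \<alpha>)
  then show ?case by (simp add: key_poly.simps[of \<alpha>] schubitope_self)
next
  case (ascent \<alpha> i j)
  let ?f = "key_poly (interchange i j \<alpha>)"
  have ne: "i \<noteq> j" using ascent.hyps by (auto simp: ascent_def consecutive_def)
  show ?case
  proof
    fix \<gamma> assume "\<gamma> \<in> Poly_Mapping.keys (key_poly \<alpha>)"
    define m where "m = entry \<gamma> i + entry \<gamma> j"
    define t where "t = entry \<gamma> i"
    have t: "t \<le> m" by (simp add: t_def m_def)
    have "Poly_Mapping.lookup (demazure i j ?f) (string_pt i j \<gamma> t) \<noteq> 0"
      using \<open>\<gamma> \<in> _\<close> key_poly_ascent[OF ascent.hyps] by (simp add: t_def string_pt_self[OF ne] in_keys_iff)
    then have "\<exists>u\<in>{max t (m - t)..m} \<union> {..<min t (m - t)}.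
        Poly_Mapping.lookup ?f (string_pt i j \<gamma> u) \<noteq> 0"
      unfolding lookup_demazure_string[OF ne m_def t]
      by (metis (no_types, lifting) UnCI diff_zero sum.neutral)
    then obtain u where u: "u \<in> {max t (m - t)..m} \<union> {..<min t (m - t)}"
      "Poly_Mapping.lookup ?f (string_pt i j \<gamma> u) \<noteq> 0" by blast
    let ?\<delta> = "string_pt i j \<gamma> u"
    have um: "u \<le> m" using u(1) by auto
    have "?\<delta> \<in> schubitope (interchange i j \<alpha>)" using ascent.IH u(2) by (auto simp: in_keys_iff)
    then have \<delta>: "?\<delta> \<in> schubitope \<alpha>" using schubitope_interchange_subset[OF ascent.hyps] by blast
    have "string_pt i j ?\<delta> t \<in> schubitope \<alpha>"
      by (intro string_pt_mem_schubitope ne \<delta> interchange_ascent_mem_schubitope[OF ascent.hyps])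
        (use u(1) ne in \<open>auto simp: entry_string_pt m_def\<close>)
    then show "\<gamma> \<in> schubitope \<alpha>"
      using um by (simp add: string_pt_string_pt[OF ne] m_def t_def string_pt_self[OF ne])
  qed
qed

text \<open>
  A longest point of the string is reached from one monomial of \<open>\<kappa>\<^bsub>\<alpha>'\<^esub>\<close> only, so no cancellation
  can occur there.
\<close>

lemma lookup_key_poly_extremal:
  "\<gamma> \<in> schubitope \<alpha> \<Longrightarrow> sqnorm \<gamma> = sqnorm \<alpha> \<Longrightarrow> Poly_Mapping.lookup (key_poly \<alpha>) \<gamma> \<noteq> 0"
proof (induction \<alpha> arbitrary: \<gamma> rule: composition_ascent_induct)
  case (weakly_decreasing \<alpha>)
  then show ?case by (simp add: key_poly.simps[of \<alpha>] schubitope_weakly_decreasing)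
next
  case (ascent \<alpha> i j)
  let ?f = "key_poly (interchange i j \<alpha>)"
  have ne: "i \<noteq> j" using ascent.hyps by (auto simp: ascent_def consecutive_def)
  from schubitope_string_source[OF ascent.hyps ascent.prems(1)] obtain \<delta> t where
    \<delta>: "\<delta> \<in> schubitope (interchange i j \<alpha>)" "entry \<delta> j \<le> t" "t \<le> entry \<delta> i"
    and \<gamma>: "\<gamma> = string_pt i j \<delta> t" .
  define m where "m = entry \<delta> i + entry \<delta> j"
  have t: "t \<le> m" using \<delta> by (simp add: m_def)
  \<comment> \<open>The length of \<open>\<delta>\<close> is at least that of
    \<open>\<gamma>\<close>, which is that of \<open>\<alpha>\<close>, and at most that of
    \<open>\<alpha>\<close>.\<close>
  have sq: "sqnorm \<gamma> = sqnorm \<delta>" "sqnorm \<delta> = sqnorm \<alpha>"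
    using sqnorm_schubitope_le[OF \<delta>(1)] ascent.prems(2) sqnorm_string_pt_le(1)[OF ne \<delta>(2,3)] \<gamma> by auto
  then have "t = entry \<delta> i \<or> t = entry \<delta> j"
    using sqnorm_string_pt_le(2)[OF ne \<delta>(2,3)] \<gamma> by simp
  then have mm: "max t (m - t) = entry \<delta> i" "min t (m - t) = entry \<delta> j"
    using \<delta>(2,3) by (auto simp: m_def)
  define F where "F u = Poly_Mapping.lookup ?f (string_pt i j \<delta> u)" for u
  \<comment> \<open>Beyond \<open>\<delta>\<close> and its mirror image the string points are longer
    than \<open>\<delta>\<close>, exceeding the bound for
    \<open>interchange i j \<alpha>\<close>.\<close>
  have F0: "F u = 0" if u: "u \<le> m" "u < entry \<delta> j \<or> entry \<delta> i < u" for u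
  proof (rule ccontr)
    assume "F u \<noteq> 0"
    then have "string_pt i j \<delta> u \<in> schubitope (interchange i j \<alpha>)"
      using keys_key_poly_subset[of "interchange i j \<alpha>"] by (auto simp: F_def in_keys_iff)
    then have "sqnorm (string_pt i j \<delta> u) \<le> sqnorm \<delta>"
      using sqnorm_schubitope_le sq(2) by fastforce
    moreover have "sqnorm (string_pt i j \<delta> u)
        = sqnorm \<delta> - 2 * (int (entry \<delta> i) - int u) * (int u - int (entry \<delta> j))"
      using u(1) by (intro sqnorm_string_pt ne) (simp add: m_def)
    ultimately have "0 \<le> (int (entry \<delta> i) - int u) * (int u - int (entry \<delta> j))"
      by linarith
    with u(2) \<delta>(2,3) show False by (auto simp: zero_le_mult_iff)
  qed
  \<comment> \<open>The subtracted sum stops before \<open>entry \<delta> j\<close>, so the mirror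
    image of \<open>\<delta>\<close> is not subtracted. Only the term at
    \<open>entry \<delta> i\<close> survives.\<close>
  have "Poly_Mapping.lookup (key_poly \<alpha>) \<gamma> = (\<Sum>u=entry \<delta> i..m. F u) - (\<Sum>u<entry \<delta> j. F u)"
    using lookup_demazure_string[OF ne m_def t, of ?f] unfolding mm
    by (simp add: key_poly_ascent[OF ascent.hyps] \<gamma> F_def)
  also have "(\<Sum>u<entry \<delta> j. F u) = 0" using F0 by (intro sum.neutral) (auto simp: m_def)
  also have "(\<Sum>u=entry \<delta> i..m. F u) = F (entry \<delta> i) + (\<Sum>u=Suc (entry \<delta> i)..m. F u)"
    by (rule sum.atLeast_Suc_atMost) (simp add: m_def)
  also have "(\<Sum>u=Suc (entry \<delta> i)..m. F u) = 0" using F0 by (intro sum.neutral) auto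
  finally have "Poly_Mapping.lookup (key_poly \<alpha>) \<gamma> = Poly_Mapping.lookup ?f \<delta>"
    by (simp add: F_def string_pt_self[OF ne])
  with ascent.IH[OF \<delta>(1)] sq show ?case by simp
qed


section \<open>Newton polytopes\<close>

abbreviation vec_of :: "'n::finite composition \<Rightarrow> real ^ 'n" where
  "vec_of \<gamma> \<equiv> \<chi> i. real (entry \<gamma> i)"

lemma vec_of_string_pt_mem_segment:
  assumes "i \<noteq> j" "entry \<gamma> j \<le> t" "t \<le> entry \<gamma> i"
  shows "vec_of (string_pt i j \<gamma> t) \<in> closed_segment (vec_of \<gamma>) (vec_of (interchange i j \<gamma>))"
proof (cases "entry \<gamma> i = entry \<gamma> j")
  case True
  with assms have "string_pt i j \<gamma> t = \<gamma>" using string_pt_self[of i j \<gamma>] by simp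
  then show ?thesis by simp
next
  case False
  define d where "d = real (entry \<gamma> i) - real (entry \<gamma> j)"
  \<comment> \<open>The fraction of the way from \<open>\<gamma>\<close> to its mirror image at
    which coordinate \<open>i\<close> equals \<open>t\<close>.\<close>
  define c where "c = (real (entry \<gamma> i) - real t) / d"
  have d: "d > 0" using False assms by (simp add: d_def)
  have c: "0 \<le> c" "c \<le> 1" using assms d by (auto simp: c_def d_def divide_simps)
  have cd: "c * (real (entry \<gamma> i) - real (entry \<gamma> j)) = real (entry \<gamma> i) - real t"
    using d unfolding c_def d_def[symmetric] by simp
  have "vec_of (string_pt i j \<gamma> t) = (1 - c) *\<^sub>R vec_of \<gamma> + c *\<^sub>R vec_of (interchange i j \<gamma>)"
    using cd assms by (auto simp: vec_eq_iff entry_string_pt Transposition.transpose_def of_nat_diff algebra_simps)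
  with c show ?thesis by (auto simp: in_segment)
qed

text \<open>The linear coordinate swap \<open>S\<close> maps the extremal points for
  \<open>interchange i j \<alpha>\<close> to extremal points for \<open>\<alpha>\<close>. Hence
  \<open>\<delta>\<close> and its mirror image lie in the hull, and so does the segment containing
  \<open>\<gamma>\<close>.\<close>

lemma schubitope_subset_hull_extremal:
  fixes \<alpha> :: "'n::{finite,linorder} composition"
  shows "\<gamma> \<in> schubitope \<alpha>
    \<Longrightarrow> vec_of \<gamma> \<in> convex hull (vec_of ` {\<delta> \<in> schubitope \<alpha>. sqnorm \<delta> = sqnorm \<alpha>})"
proof (induction \<alpha> arbitrary: \<gamma> rule: composition_ascent_induct)
  case (weakly_decreasing \<alpha>)
  then show ?case by (auto simp: schubitope_weakly_decreasing intro: hull_inc)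
next
  case (ascent \<alpha> i j)
  let ?V = "\<lambda>\<alpha>. {\<delta> \<in> schubitope \<alpha>. sqnorm \<delta> = sqnorm \<alpha>}"
  let ?\<alpha> = "interchange i j \<alpha>"
  define S :: "(real, 'n) vec \<Rightarrow> (real, 'n) vec" where "S x = (\<chi> k. x $ Transposition.transpose i j k)" for x
  have S: "linear S" by (rule linearI) (simp_all add: S_def vec_eq_iff)
  have S_vec: "S (vec_of \<delta>) = vec_of (interchange i j \<delta>)" for \<delta>
    by (simp add: S_def vec_eq_iff)
  have ne: "i \<noteq> j" using ascent.hyps by (auto simp: ascent_def consecutive_def)
  from schubitope_string_source[OF ascent.hyps ascent.prems] obtain \<delta> t where
    \<delta>: "\<delta> \<in> schubitope ?\<alpha>" "entry \<delta> j \<le> t" "t \<le> entry \<delta> i"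
    and \<gamma>: "\<gamma> = string_pt i j \<delta> t" .
  have sub: "?V ?\<alpha> \<subseteq> ?V \<alpha>"
    using schubitope_interchange_subset[OF ascent.hyps] by auto
  then have "S ` vec_of ` ?V ?\<alpha> \<subseteq> vec_of ` ?V \<alpha>"
    using interchange_ascent_mem_schubitope[OF ascent.hyps] by (force simp: S_vec)
  then have "S ` (convex hull (vec_of ` ?V ?\<alpha>)) \<subseteq> convex hull (vec_of ` ?V \<alpha>)"
    unfolding convex_hull_linear_image[OF S] by (rule hull_mono)
  then have "S (vec_of \<delta>) \<in> convex hull (vec_of ` ?V \<alpha>)"
    using ascent.IH[OF \<delta>(1)] by blast
  moreover have "vec_of \<delta> \<in> convex hull (vec_of ` ?V \<alpha>)"
    using ascent.IH[OF \<delta>(1)] by (rule subsetD[OF hull_mono[OF image_mono[OF sub]]])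
  ultimately have "closed_segment (vec_of \<delta>) (vec_of (interchange i j \<delta>)) \<subseteq> convex hull (vec_of ` ?V \<alpha>)"
    unfolding S_vec by (intro closed_segment_subset convex_convex_hull)
  with vec_of_string_pt_mem_segment[OF ne \<delta>(2,3)] \<gamma> show ?case by blast
qed

text \<open>Each capacity constraint is a half-space and the total weight a hyperplane, with normals
  the indicator vectors \<open>a I\<close>. Both are convex, so the hull inherits them.\<close>

lemma mem_schubitope_hull:
  fixes \<alpha> :: "'n::{finite,linorder} composition"
  assumes "vec_of \<gamma> \<in> convex hull (vec_of ` A)" "A \<subseteq> schubitope \<alpha>"
  shows "\<gamma> \<in> schubitope \<alpha>"
proof -
  define a :: "'n set \<Rightarrow> (real, 'n) vec" where "a I = (\<chi> k. if k \<in> I then 1 else 0)" for I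
  have a: "a I \<bullet> vec_of \<delta> = real (wt \<delta> I)" for I \<delta>
    by (simp add: a_def inner_vec_def wt_def if_distrib[of "\<lambda>x. x * _"] sum.If_cases cong: if_cong)
  have "convex hull (vec_of ` A) \<subseteq> {x. a I \<bullet> x \<le> real (capacity \<alpha> I)}" for I
    using assms(2) by (intro hull_minimal convex_halfspace_le) (auto simp: a schubitope_def)
  then have "a I \<bullet> vec_of \<gamma> \<le> real (capacity \<alpha> I)" for I
    using assms(1) by blast
  moreover have "convex hull (vec_of ` A) \<subseteq> {x. a UNIV \<bullet> x = real (wt \<alpha> UNIV)}"
    using assms(2) by (intro hull_minimal convex_hyperplane) (auto simp: a schubitope_def)
  then have "a UNIV \<bullet> vec_of \<gamma> = real (wt \<alpha> UNIV)"
    using assms(1) by blast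
  ultimately show ?thesis by (simp add: a schubitope_def)
qed

theorem corollary1p2:
  fixes \<alpha> \<beta> :: "'n::{finite,linorder} composition"
  shows "newton (key_poly \<beta>) \<subseteq> newton (key_poly \<alpha>) \<longleftrightarrow> \<beta> \<le>\<^sub>\<kappa> \<alpha>"
proof
  assume sub: "newton (key_poly \<beta>) \<subseteq> newton (key_poly \<alpha>)"
  \<comment> \<open>\<open>\<beta>\<close> is an extremal point of its own
    \<open>schubitope\<close>, so its monomial survives.\<close>
  have "\<beta> \<in> Poly_Mapping.keys (key_poly \<beta>)"
    using lookup_key_poly_extremal[OF schubitope_self] by (simp add: in_keys_iff)
  then have "vec_of \<beta> \<in> newton (key_poly \<beta>)"
    unfolding newton_def by (intro hull_inc imageI)
  with sub have "\<beta> \<in> schubitope \<alpha>"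
    unfolding newton_def by (intro mem_schubitope_hull[OF _ keys_key_poly_subset]) blast
  then show "\<beta> \<le>\<^sub>\<kappa> \<alpha>" by (rule schubitope_imp_kappa_le)
next
  assume le: "\<beta> \<le>\<^sub>\<kappa> \<alpha>"
  \<comment> \<open>The extremal points are in the support, and their hull contains all of
    \<open>schubitope \<alpha>\<close>, which by transitivity contains
    \<open>schubitope \<beta>\<close>.\<close>
  have "{\<delta> \<in> schubitope \<alpha>. sqnorm \<delta> = sqnorm \<alpha>} \<subseteq> Poly_Mapping.keys (key_poly \<alpha>)"
    by (auto simp: in_keys_iff lookup_key_poly_extremal)
  then have "convex hull (vec_of ` {\<delta> \<in> schubitope \<alpha>. sqnorm \<delta> = sqnorm \<alpha>}) \<subseteq> newton (key_poly \<alpha>)"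
    unfolding newton_def by (intro hull_mono image_mono)
  then have hull: "vec_of \<gamma> \<in> newton (key_poly \<alpha>)" if "\<gamma> \<in> schubitope \<alpha>" for \<gamma>
    using schubitope_subset_hull_extremal[OF that] by blast
  have "schubitope \<beta> \<subseteq> schubitope \<alpha>"
    using le kappa_le_trans by (auto simp: mem_schubitope_iff)
  with keys_key_poly_subset[of \<beta>] hull
  have "vec_of ` Poly_Mapping.keys (key_poly \<beta>) \<subseteq> newton (key_poly \<alpha>)" by auto
  then show "newton (key_poly \<beta>) \<subseteq> newton (key_poly \<alpha>)"
    unfolding newton_def[of "key_poly \<beta>"]
    by (rule hull_minimal) (simp add: newton_def convex_convex_hull)
qed

end
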